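(* Let $(\mathbb{X},\oplus,\otimes,\mathbb{0},\mathbb{1})$ be a linearly ordered idempotent semifield in which, for every $a\in\mathbb{X}$ and every integer $p>0$, the equation $x^p=a$ has a unique solution. Let $\bm{A},\bm{B},\bm{C}\in\mathbb{X}^{n\times n}$, where $\bm{A}$ and $\bm{B}$ have respective spectral radii $\lambda>\mathbb{0}$ and $\mu>\mathbb{0}$, and $\mathrm{Tr}(\bm{C})\le\mathbb{1}$. Consider the bi-objective problem of finding regular vectors $\bm{x}\in\mathbb{X}^n$ that $$\text{minimize}\quad (\bm{x}^{-}\bm{A}\bm{x},\ \bm{x}^{-}\bm{B}\bm{x})\qquad\text{subject to}\quad \bm{C}\bm{x}\le\bm{x}.\qquad (P)$$ With the scalars $\lambda,\mu,\sigma,\theta$ and the functions $G,H$ associated with $\bm{A},\bm{B},\bm{C}$ as defined in the context, the following statements hold. 1. If $H(\mu\oplus\theta)\le\lambda\oplus\sigma$, then the Pareto frontier of problem (P) reduces to the single point $(\alpha,\beta)$ with $$\alpha=\lambda\oplus\sigma,\qquad \beta=\mu\oplus\theta.$$ 2. If $H(\mu\oplus\theta)>\lambda\oplus\sigma$, then the Pareto frontier of problem (P) is the segment consisting of all points $(\alpha,\beta)$ defined by $$\lambda\oplus\sigma\le\alpha\le H(\mu\oplus\theta),\qquad \beta=G(\alpha).$$ 3. All Pareto-optimal solutions of problem (P) are given in parametric form by $$\bm{x}=(\alpha^{-1}\bm{A}\oplus\beta^{-1}\bm{B}\oplus\bm{C})^{\ast}\bm{u},\qquad \bm{u}>\bm{0},$$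 where $(\alpha,\beta)$ ranges over the Pareto frontier described in items 1 and 2, and $\bm{u}\in\mathbb{X}^n$ ranges over all regular vectors. That is, the set of Pareto-optimal solutions is exactly the set of all such vectors $\bm{x}$.
   Context: **Semifield.** An idempotent semifield $(\mathbb{X},\oplus,\otimes,\mathbb{0},\mathbb{1})$ is a set $\mathbb{X}$ with two operations such that $(\mathbb{X},\oplus,\mathbb{0})$ is a commutative idempotent monoid ($x\oplus x=x$), $(\mathbb{X}\setminus\{\mathbb{0}\},\otimes,\mathbb{1})$ is an Abelian group, $\otimes$ distributes over $\oplus$, and $\mathbb{0}$ is absorbing for $\otimes$. The sign $\otimes$ is omitted. The order is $x\le y$ if and only if $x\oplus y=y$; it is assumed to be linear (total), so that $x\oplus y=\max\{x,y\}$. For $x\ne\mathbb{0}$, $x^{-1}$ is the multiplicative inverse, and integer powers are iterated products, with $x^0=\mathbb{1}$ and $x^{-p}=(x^{-1})^p$; for an integer $p>0$, $\mathbb{0}^p=\mathbb{0}$. Since $x^p=a$ is uniquely solvable for every $a\in\mathbb{X}$ and integer $p>0$, rational powers are defined. The symbol $\bigoplus$ denotes iterated $\oplus$, with an empty sum equal to $\mathbb{0}$. (Example: $\mathbb{R}_{\max}=(\mathbb{R}_+,\max,\times,0,1)$, with $\mathbb{R}_+$ the non-negative reals.) **Matrices and vectors.** Matrix addition, matrix multiplication and scalar multiplication follow the usual rules with $+,\times$ replaced by $\oplus,\otimes$. Inequalities between matrices or vectors are entrywise. $\bm{I}$ is the identity matrix (diagonal entries $\mathbb{1}$, other entries $\mathbb{0}$),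 and $\bm{0}$ is the zero vector. Powers are $\bm{A}^0=\bm{I}$ (for every square $\bm{A}$) and $\bm{A}^p=\bm{A}\bm{A}^{p-1}$. Vectors in $\mathbb{X}^n$ are columns. A vector is regular if it has no entry equal to $\mathbb{0}$; the notation $\bm{u}>\bm{0}$ means that $\bm{u}$ is regular. For a nonzero vector $\bm{x}=(x_j)$, $\bm{x}^{-}$ is the row vector with entries $x_j^{-1}$ if $x_j\ne\mathbb{0}$ and $\mathbb{0}$ otherwise. For $\bm{A}=(a_{ij})\in\mathbb{X}^{n\times n}$: - $\mathrm{tr}\,\bm{A}=a_{11}\oplus\cdots\oplus a_{nn}$, and $\mathrm{tr}^{1/k}(\bm{A})$ denotes $(\mathrm{tr}\,\bm{A})^{1/k}$; - $\mathrm{Tr}(\bm{A})=\mathrm{tr}\,\bm{A}\oplus\cdots\oplus\mathrm{tr}\,\bm{A}^n$; - if $\mathrm{Tr}(\bm{A})\le\mathbb{1}$, the Kleene star is $\bm{A}^{\ast}=\bm{I}\oplus\bm{A}\oplus\cdots\oplus\bm{A}^{n-1}$; - the spectral radius of $\bm{A}$ (its maximum eigenvalue) is $\bigoplus_{k=1}^{n}\mathrm{tr}^{1/k}(\bm{A}^k)$. **Scalars and functions associated with $\bm{A},\bm{B},\bm{C}$.** The spectral radii of $\bm{A}$ and $\bm{B}$ are $$\lambda=\bigoplus_{k=1}^{n}\mathrm{tr}^{1/k}(\bm{A}^k),\qquad \mu=\bigoplus_{k=1}^{n}\mathrm{tr}^{1/k}(\bm{B}^k).$$ Further, $$\sigma=\bigoplus_{k=1}^{n-1}\bigoplus_{m=1}^{n-k}\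 \bigoplus_{\substack{i_1+\cdots+i_k=m\\ i_1,\ldots,i_k\ge0}}\mathrm{tr}^{1/m}(\bm{A}^{i_1}\bm{C}\cdots\bm{A}^{i_k}\bm{C}),$$ $$\theta=\bigoplus_{k=1}^{n-1}\bigoplus_{m=1}^{n-k}\ \bigoplus_{\substack{i_1+\cdots+i_k=m\\ i_1,\ldots,i_k\ge0}}\mathrm{tr}^{1/m}(\bm{B}^{i_1}\bm{C}\cdots\bm{B}^{i_k}\bm{C}).$$ For $k=1,\ldots,n-1$, $l=1,\ldots,k$ and $m=1,\ldots,n-k$, $$r_{k,l,m}=\bigoplus_{\substack{i_1+\cdots+i_k=m\\ i_1,\ldots,i_k\ge0}}\ \bigoplus_{\substack{j_1+\cdots+j_k=l\\ j_1,\ldots,j_k\in\{0,1\}}}\mathrm{tr}(\bm{A}^{i_1}\bm{B}^{j_1}\bm{C}^{1-j_1}\cdots\bm{A}^{i_k}\bm{B}^{j_k}\bm{C}^{1-j_k}).$$ For $s,t\in\mathbb{X}$ with $s,t>\mathbb{0}$, $$G(s)=\bigoplus_{k=1}^{n-1}\bigoplus_{m=1}^{n-k}\bigoplus_{l=1}^{k}r_{k,l,m}^{1/l}\,s^{-m/l},\qquad H(t)=\bigoplus_{k=1}^{n-1}\bigoplus_{m=1}^{n-k}\bigoplus_{l=1}^{k}r_{k,l,m}^{1/m}\,t^{-l/m}.$$ **Pareto optimality.** A feasible vector for (P) is a regular $\bm{x}\in\mathbb{X}^n$ with $\bm{C}\bm{x}\le\bm{x}$. A feasible $\bm{x}$ is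 a Pareto-optimal solution if there is no feasible $\bm{y}$ with $\bm{y}^{-}\bm{A}\bm{y}\le\bm{x}^{-}\bm{A}\bm{x}$ and $\bm{y}^{-}\bm{B}\bm{y}\le\bm{x}^{-}\bm{B}\bm{x}$ where at least one of the two inequalities is strict. The Pareto frontier is the set of all pairs $(\alpha,\beta)=(\bm{x}^{-}\bm{A}\bm{x},\bm{x}^{-}\bm{B}\bm{x})$ with $\bm{x}$ Pareto-optimal. *)

theory Defs
  imports "HOL-Analysis.Analysis"
begin

section \<open>Linearly ordered radicable idempotent semifields\<close>

text \<open>
  The operations \<open>\<oplus>\<close>, \<open>\<otimes>\<close>, \<open>\<zero>\<close>, \<open>\<one>\<close> are written \<open>+\<close>, \<open>*\<close>, \<open>0\<close>, \<open>1\<close>.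
  Iterated addition is \<^const>\<open>sum\<close>, powers are those of \<^class>\<open>monoid_mult\<close>, and
  \<open>0 \<noteq> 1\<close> (the unit belongs to the group of nonzero elements) is part of
  \<^class>\<open>comm_semiring_1\<close>. The value of \<open>inverse 0\<close> is left unspecified.
\<close>

class linordered_idem_semifield = comm_semiring_1 + linorder + inverse +
  assumes add_idem: "x + x = x"
    and le_iff_add_eq: "x \<le> y \<longleftrightarrow> x + y = y"
    and left_inverse_nonzero: "x \<noteq> 0 \<Longrightarrow> inverse x * x = 1"
    and divide_eq_mult_inverse: "x / y = x * inverse y"

class radicable_semifield = linordered_idem_semifield +
  assumes ex1_root: "p > 0 \<Longrightarrow> \<exists>!x. x ^ p = a"

definition root_of :: "nat \<Rightarrow> 'a::radicable_semifield \<Rightarrow> 'a" where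
  "root_of p a = (THE x. x ^ p = a)"

text \<open>
  The exponent \<open>q\<close> is taken in lowest terms; lemma \<open>powq_power\<close> below shows that any other
  representation with positive denominator gives the same power.
\<close>

definition powq :: "'a::radicable_semifield \<Rightarrow> rat \<Rightarrow> 'a" (infixr \<open>powq\<close> 80) where
  "x powq q = (case quotient_of q of (m, p) \<Rightarrow> root_of (nat p) (x powi m))"

lemma root_of_power: "p > 0 \<Longrightarrow> root_of p a ^ p = a"
  unfolding root_of_def by (rule theI') (rule ex1_root)

lemma root_of_unique: "p > 0 \<Longrightarrow> x ^ p = a \<Longrightarrow> root_of p a = x"
  using ex1_root root_of_power by metis

lemma powq_power:
  assumes "p > 0"
  shows "(x powq (of_int m / of_nat p)) ^ p = x powi m"
proof -
  obtain a b where ab: "quotient_of (of_int m / of_nat p) = (a, b)"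
    by (metis surj_pair)
  have b: "b > 0" and cop: "coprime a b"
    and q: "(of_int m / of_nat p :: rat) = of_int a / of_int b"
    using ab quotient_of_denom_pos quotient_of_coprime quotient_of_div by blast+
  have "(of_int (m * b) :: rat) = of_int (a * int p)"
    using q b assms by (simp add: field_simps)
  then have eq: "m * b = a * int p"
    by (simp only: of_int_eq_iff)
  then have "b dvd int p"
    using cop by (metis coprime_commute coprime_dvd_mult_right_iff dvd_triv_right)
  then obtain c where c: "int p = b * c" ..
  then have "c > 0"
    using b assms by (metis of_nat_0_less_iff zero_less_mult_pos)
  then obtain d where d: "c = int d" "d > 0"
    by (metis zero_less_imp_eq_int)
  have p: "p = nat b * d"
    using c d b by (metis nat_int nat_mult_distrib order_less_imp_le)
  have m: "m = a * int d"
    using eq c d b by auto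
  have root: "x powq (of_int m / of_nat p) = root_of (nat b) (x powi a)"
    by (simp add: powq_def ab)
  have "(x powq (of_int m / of_nat p)) ^ p = (root_of (nat b) (x powi a) ^ nat b) ^ d"
    unfolding root by (simp add: p power_mult)
  also have "\<dots> = (x powi a) ^ d"
    using b by (simp add: root_of_power)
  also have "\<dots> = x powi m"
    using d(2) by (auto simp: m power_int_def zero_le_mult_iff nat_mult_distrib power_mult
        simp flip: mult_minus_left)
  finally show ?thesis .
qed


section \<open>Matrices and vectors\<close>

text \<open>
  The multiplication and the powers that the library puts on \<open>'a ^ 'n ^ 'n\<close> as a type are
  entrywise; the matrix product is \<open>**\<close>, and its powers are \<open>matpow\<close>.
\<close>

fun matpow :: "'a::semiring_1 ^'n^'n \<Rightarrow> nat \<Rightarrow> 'a ^'n^'n" where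
  "matpow A 0 = mat 1"
| "matpow A (Suc p) = A ** matpow A p"

definition mat_prod_list :: "('a::semiring_1 ^'n^'n) list \<Rightarrow> 'a ^'n^'n" where
  "mat_prod_list Ms = foldr (**) Ms (mat 1)"

definition mat_scale :: "'a::semiring_1 \<Rightarrow> 'a ^'n^'m \<Rightarrow> 'a ^'n^'m" where
  "mat_scale c A = (\<chi> i j. c * A $ i $ j)"

definition regular :: "'a::zero ^'n \<Rightarrow> bool" where
  "regular x \<longleftrightarrow> (\<forall>i. x $ i \<noteq> 0)"

definition vec_conj :: "'a::linordered_idem_semifield ^'n \<Rightarrow> 'a ^'n" where
  "vec_conj x = (\<chi> j. if x $ j \<noteq> 0 then inverse (x $ j) else 0)"

definition conj_form :: "'a::linordered_idem_semifield ^'n \<Rightarrow> 'a ^'n^'n \<Rightarrow> 'a" where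
  "conj_form x A = scalar_product (vec_conj x) (A *v x)"

definition Tr :: "'a::linordered_idem_semifield ^'n^'n \<Rightarrow> 'a" where
  "Tr A = (\<Sum>k = 1..CARD('n). trace (matpow A k))"

text \<open>The Kleene star exists only under the condition \<open>Tr A \<le> 1\<close>.\<close>

definition kleene_star :: "'a::linordered_idem_semifield ^'n^'n \<Rightarrow> 'a ^'n^'n" where
  "kleene_star A = (if Tr A \<le> 1 then \<Sum>k = 0..CARD('n) - 1. matpow A k else undefined)"

definition spectral_radius :: "'a::radicable_semifield ^'n^'n \<Rightarrow> 'a" where
  "spectral_radius A = (\<Sum>k = 1..CARD('n). trace (matpow A k) powq (1 / of_nat k))"


section \<open>Scalars and functions associated with the matrices\<close>

text \<open>
  A multi-index \<open>(i\<^sub>1, \<dots>, i\<^sub>k)\<close> with \<open>i\<^sub>1 + \<dots> + i\<^sub>k = m\<close> is a list of length \<open>k\<close> with sum \<open>m\<close>.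
  There are finitely many of them, so the sums over these sets are genuine.
\<close>

definition multi_indices :: "nat \<Rightarrow> nat \<Rightarrow> nat list set" where
  "multi_indices k m = {is. length is = k \<and> sum_list is = m}"

definition binary_multi_indices :: "nat \<Rightarrow> nat \<Rightarrow> nat list set" where
  "binary_multi_indices k l = {js. length js = k \<and> sum_list js = l \<and> set js \<subseteq> {0, 1}}"

lemma finite_multi_indices: "finite (multi_indices k m)"
proof (rule finite_subset)
  show "multi_indices k m \<subseteq> {is. set is \<subseteq> {..m} \<and> length is = k}"
    by (auto simp: multi_indices_def intro: member_le_sum_list)
  show "finite {is. set is \<subseteq> {..m} \<and> length is = k}"
    by (rule finite_lists_length_eq) simp
qed

lemma finite_binary_multi_indices: "finite (binary_multi_indices k l)"
  by (rule finite_subset[OF _ finite_multi_indices[of k l]])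
    (auto simp: multi_indices_def binary_multi_indices_def)

text \<open>\<open>\<sigma>\<close> is \<open>mixed_radius A C\<close>, and \<open>\<theta>\<close> is \<open>mixed_radius B C\<close>.\<close>

definition mixed_radius ::
  "'a::radicable_semifield ^'n^'n \<Rightarrow> 'a ^'n^'n \<Rightarrow> 'a" where
  "mixed_radius A C =
    (\<Sum>k = 1..CARD('n) - 1. \<Sum>m = 1..CARD('n) - k. \<Sum>is\<in>multi_indices k m.
      trace (mat_prod_list (map (\<lambda>i. matpow A i ** C) is)) powq (1 / of_nat m))"

definition r_coeff ::
  "'a::linordered_idem_semifield ^'n^'n \<Rightarrow> 'a ^'n^'n \<Rightarrow> 'a ^'n^'n \<Rightarrow> nat \<Rightarrow> nat \<Rightarrow> nat \<Rightarrow> 'a" where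
  "r_coeff A B C k l m =
    (\<Sum>is\<in>multi_indices k m. \<Sum>js\<in>binary_multi_indices k l.
      trace (mat_prod_list
        (map2 (\<lambda>i j. matpow A i ** matpow B j ** matpow C (1 - j)) is js)))"

definition G_fun ::
  "'a::radicable_semifield ^'n^'n \<Rightarrow> 'a ^'n^'n \<Rightarrow> 'a ^'n^'n \<Rightarrow> 'a \<Rightarrow> 'a" where
  "G_fun A B C s =
    (\<Sum>k = 1..CARD('n) - 1. \<Sum>m = 1..CARD('n) - k. \<Sum>l = 1..k.
      r_coeff A B C k l m powq (1 / of_nat l) * s powq (- (of_nat m / of_nat l)))"

definition H_fun ::
  "'a::radicable_semifield ^'n^'n \<Rightarrow> 'a ^'n^'n \<Rightarrow> 'a ^'n^'n \<Rightarrow> 'a \<Rightarrow> 'a" where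
  "H_fun A B C t =
    (\<Sum>k = 1..CARD('n) - 1. \<Sum>m = 1..CARD('n) - k. \<Sum>l = 1..k.
      r_coeff A B C k l m powq (1 / of_nat m) * t powq (- (of_nat l / of_nat m)))"


section \<open>Pareto optimality\<close>

definition feasible :: "'a::linordered_idem_semifield ^'n^'n \<Rightarrow> 'a ^'n \<Rightarrow> bool" where
  "feasible C x \<longleftrightarrow> regular x \<and> C *v x \<le> x"

definition pareto_optimal ::
  "'a::linordered_idem_semifield ^'n^'n \<Rightarrow> 'a ^'n^'n \<Rightarrow> 'a ^'n^'n \<Rightarrow> 'a ^'n \<Rightarrow> bool" where
  "pareto_optimal A B C x \<longleftrightarrow> feasible C x \<and>
    \<not> (\<exists>y. feasible C y \<and>
          conj_form y A \<le> conj_form x A \<and> conj_form y B \<le> conj_form x B \<and>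
          (conj_form y A < conj_form x A \<or> conj_form y B < conj_form x B))"

definition pareto_frontier ::
  "'a::linordered_idem_semifield ^'n^'n \<Rightarrow> 'a ^'n^'n \<Rightarrow> 'a ^'n^'n \<Rightarrow> ('a \<times> 'a) set" where
  "pareto_frontier A B C = {(conj_form x A, conj_form x B) | x. pareto_optimal A B C x}"

end

theory Submission
  imports Defs
begin

text \<open>
  For regular \<open>x\<close> an objective satisfies \<open>x\<^sup>- A x \<le> \<alpha>\<close> exactly when \<open>A x \<le> \<alpha> x\<close>. Hence, for nonzero \<open>\<alpha>\<close>
  and \<open>\<beta>\<close>, a regular vector is feasible with objectives at most \<open>(\<alpha>, \<beta>)\<close> if and only if \<open>M x \<le> x\<close>
  for the single matrix \<open>M = \<alpha>\<inverse> A \<oplus> \<beta>\<inverse> B \<oplus> C\<close> (\<open>feasible_bounds_iff\<close>). If \<open>Tr M \<le> \<one>\<close>, the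
  regular solutions of \<open>M x \<le> x\<close> are the vectors \<open>M\<^sup>* u\<close> with \<open>u\<close> regular: no closed walk
  has weight above \<open>\<one>\<close>, so deleting cycles from a walk never lowers its weight, and \<open>M\<^sup>*\<close> dominates all
  powers of \<open>M\<close> (\<open>matpow_le_kleene_star\<close>).

  It remains to see for which \<open>(\<alpha>, \<beta>)\<close> there is such a vector. Expanding the powers of \<open>M\<close>,
  \<open>Tr M \<le> \<one>\<close> bounds the traces of all products of at most \<open>n\<close> factors \<open>A\<close>, \<open>B\<close>, \<open>C\<close>: if \<open>A\<close>
  occurs \<open>m\<close> times and \<open>B\<close> occurs \<open>l\<close> times, the trace is at most \<open>\<alpha>\<^sup>m \<beta>\<^sup>l\<close>. The trace is
  invariant under cyclic rotation, so the products may be sorted by the letters that occur in them.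
  Those in \<open>A\<close> alone give \<open>\<lambda> \<le> \<alpha>\<close>, those in \<open>A\<close> and \<open>C\<close> give \<open>\<sigma> \<le> \<alpha>\<close>, and symmetrically
  \<open>\<mu> \<oplus> \<theta> \<le> \<beta>\<close>; those that contain both \<open>A\<close> and \<open>B\<close> give \<open>r\<^sub>k\<^sub>l\<^sub>m \<le> \<alpha>\<^sup>m \<beta>\<^sup>l\<close>, that is,
  \<open>G(\<alpha>) \<le> \<beta>\<close>. A pair that satisfies these inequalities is called admissible. Together with \<open>Tr C \<le> \<one>\<close> they
  imply \<open>Tr M \<le> \<one>\<close> (\<open>Tr_le_1_if_admissible\<close>). Conversely, the objective values of a feasible vector
  form an admissible pair (\<open>feasible_admissible\<close>), since a regular subeigenvector
  passes to products of matrices and bounds their traces.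

  So a feasible vector is Pareto-optimal if and only if its objective values form a minimal
  admissible pair. The admissible region is cut out by two lower bounds and the curve \<open>\<beta> = G(\<alpha>)\<close>. Since
  \<open>G(\<alpha>) \<le> \<beta>\<close> is equivalent to \<open>H(\<beta>) \<le> \<alpha>\<close> and \<open>G\<close> is strictly decreasing where it is nonzero,
  its minimal elements are the corner, if the corner lies on or above the curve, and otherwise the piece of the
  curve between the two bounds.
\<close>

section \<open>Order and powers in the semifield\<close>

subclass (in linordered_idem_semifield) ordered_comm_semiring
proof
  fix a b c :: 'a
  assume "a \<le> b"
  then have "a + b = b"
    by (simp add: le_iff_add_eq)
  then show "c + a \<le> c + b" "c * a \<le> c * b"
    by (metis add_idem local.add.assoc local.add.commute le_iff_add_eq)
       (metis \<open>a + b = b\<close> local.distrib_left le_iff_add_eq)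
qed

instance linordered_idem_semifield \<subseteq> canonically_ordered_monoid_add
  by standard (metis add_idem add.assoc le_iff_add_eq)

lemma idem_add_le_iff:
  fixes x y c :: "'a::linordered_idem_semifield"
  shows "x + y \<le> c \<longleftrightarrow> x \<le> c \<and> y \<le> c"
  by (metis add.assoc add.commute add_idem le_iff_add_eq)

lemma idem_sum_le_iff:
  fixes f :: "'b \<Rightarrow> 'a::linordered_idem_semifield"
  assumes "finite S"
  shows "sum f S \<le> c \<longleftrightarrow> (\<forall>x\<in>S. f x \<le> c)"
  using assms by induction (simp_all add: idem_add_le_iff)

lemma idem_sum_attained:
  fixes f :: "'b \<Rightarrow> 'a::linordered_idem_semifield"
  assumes "sum f S \<noteq> 0"
  shows "\<exists>x\<in>S. f x = sum f S"
proof -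
  have "finite S"
    using assms sum.infinite by blast
  then show ?thesis
    using assms
  proof induction
    case (insert x S)
    have "f x + sum f S = f x \<or> f x + sum f S = sum f S"
      by (metis add.commute le_iff_add_eq linear)
    with insert show ?case
      by (cases "sum f S = 0") auto
  qed simp
qed

lemma mult_le_cancel_nonzero:
  fixes x y z :: "'a::linordered_idem_semifield"
  assumes "z \<noteq> 0"
  shows "z * x \<le> z * y \<longleftrightarrow> x \<le> y"
proof
  assume "z * x \<le> z * y"
  then have "inverse z * (z * x) \<le> inverse z * (z * y)"
    by (rule mult_left_mono) simp
  then show "x \<le> y"
    using assms by (simp add: left_inverse_nonzero flip: mult.assoc)
qed (simp add: mult_left_mono)

lemma idem_mult_mono:
  fixes x y z w :: "'a::linordered_idem_semifield"
  shows "x \<le> y \<Longrightarrow> z \<le> w \<Longrightarrow> x * z \<le> y * w"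
  by (rule mult_mono) simp_all

lemma idem_power_mono:
  fixes x y :: "'a::linordered_idem_semifield"
  shows "x \<le> y \<Longrightarrow> x ^ p \<le> y ^ p"
  by (induction p) (simp_all add: idem_mult_mono)

lemma inverse_mult_le_iff:
  fixes x y z :: "'a::linordered_idem_semifield"
  assumes "z \<noteq> 0"
  shows "inverse z * x \<le> y \<longleftrightarrow> x \<le> z * y"
  using mult_le_cancel_nonzero[OF assms, of "inverse z * x" y] left_inverse_nonzero[OF assms]
  by (metis mult.assoc mult.commute mult_1)

lemma nonzero_mult:
  fixes x y :: "'a::linordered_idem_semifield"
  assumes "x \<noteq> 0" "y \<noteq> 0"
  shows "x * y \<noteq> 0"
  by (metis assms left_inverse_nonzero mult.assoc mult_1 mult_zero_right)

lemma nonzero_power: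
  fixes x :: "'a::linordered_idem_semifield"
  shows "x \<noteq> 0 \<Longrightarrow> x ^ p \<noteq> 0"
  by (induction p) (simp_all add: nonzero_mult)

lemma inverse_power_mult:
  fixes x :: "'a::linordered_idem_semifield"
  assumes "x \<noteq> 0"
  shows "inverse x ^ p * x ^ p = 1"
  by (simp add: left_inverse_nonzero[OF assms] flip: power_mult_distrib)

text \<open>If \<open>x ^ p \<le> y ^ p\<close> although \<open>y \<le> x\<close>, the two powers agree, and so do \<open>x\<close> and \<open>y\<close> by the
  uniqueness of roots.\<close>

lemma power_le_iff:
  fixes x y :: "'a::radicable_semifield"
  assumes "p > 0"
  shows "x ^ p \<le> y ^ p \<longleftrightarrow> x \<le> y"
  by (metis assms idem_power_mono linorder_linear order_antisym root_of_unique)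

lemma powq_root_le_iff:
  fixes r :: "'a::radicable_semifield"
  assumes "p > 0"
  shows "r powq (1 / of_nat p) \<le> c \<longleftrightarrow> r \<le> c ^ p"
  using powq_power[OF assms, of r 1] power_le_iff[OF assms, of "r powq (1 / of_nat p)" c]
  by simp

lemma powq_term_power:
  fixes r s :: "'a::radicable_semifield"
  assumes "p > 0"
  shows "(r powq (1 / of_nat p) * s powq (- (of_nat q / of_nat p))) ^ p = r * inverse s ^ q"
proof -
  have "(s powq (- (of_nat q / of_nat p))) ^ p = inverse s ^ q"
    using powq_power[OF assms, of s "- int q"] by (cases "q = 0") (simp_all add: power_int_def)
  with powq_power[OF assms, of r 1] show ?thesis
    by (simp add: power_mult_distrib)
qed

text \<open>Both \<open>G\<close> and \<open>H\<close> consist of terms \<open>r\<^bsup>1/p\<^esup> s\<^bsup>-q/p\<^esup>\<close>, and this turns a bound on such a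
  term into a bound free of roots and inverses, in which the two arguments are symmetric.\<close>

lemma powq_term_le_iff:
  fixes r s :: "'a::radicable_semifield"
  assumes "p > 0" "s \<noteq> 0"
  shows "r powq (1 / of_nat p) * s powq (- (of_nat q / of_nat p)) \<le> c \<longleftrightarrow> r \<le> s ^ q * c ^ p"
proof -
  have "r powq (1 / of_nat p) * s powq (- (of_nat q / of_nat p)) \<le> c \<longleftrightarrow>
      inverse s ^ q * r \<le> c ^ p"
    by (subst power_le_iff[OF assms(1), symmetric])
      (simp add: powq_term_power[OF assms(1)] mult.commute)
  also have "\<dots> \<longleftrightarrow> s ^ q * (inverse s ^ q * r) \<le> s ^ q * c ^ p"
    by (rule mult_le_cancel_nonzero[symmetric]) (rule nonzero_power[OF assms(2)])
  also have "s ^ q * (inverse s ^ q * r) = r"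
    using inverse_power_mult[OF assms(2), of q] by (metis mult.assoc mult.commute mult_1)
  finally show ?thesis .
qed

lemma powq_term_eq_imp:
  fixes r s :: "'a::radicable_semifield"
  assumes "p > 0" "s \<noteq> 0"
    and "r powq (1 / of_nat p) * s powq (- (of_nat q / of_nat p)) = c"
  shows "r = s ^ q * c ^ p"
proof -
  have "c ^ p = r * inverse s ^ q"
    using powq_term_power[OF assms(1), of r s q] assms(3) by simp
  then show ?thesis
    using inverse_power_mult[OF assms(2), of q] by (metis mult.assoc mult.commute mult_1_right)
qed


section \<open>Matrix products and their traces\<close>

lemma trace_mult_commute:
  fixes M N :: "'a::comm_semiring_1 ^'n^'n"
  shows "trace (M ** N) = trace (N ** M)"
  by (simp add: trace_def matrix_matrix_mult_def, subst sum.swap, simp add: mult.commute)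

lemma trace_add_semiring:
  fixes M N :: "'a::semiring_1 ^'n^'n"
  shows "trace (M + N) = trace M + trace N"
  by (simp add: trace_def sum.distrib)

lemma matrix_add_rdistrib_semiring:
  fixes L M :: "'a::semiring_1 ^'m^'n"
  shows "(L + M) ** N = L ** N + M ** N"
  by (simp add: vec_eq_iff matrix_matrix_mult_def distrib_right sum.distrib)

lemma trace_mat_scale:
  fixes M :: "'a::semiring_1 ^'n^'n"
  shows "trace (mat_scale c M) = c * trace M"
  by (simp add: trace_def mat_scale_def sum_distrib_left)

lemma mat_prod_list_Nil [simp]: "mat_prod_list [] = mat 1"
  by (simp add: mat_prod_list_def)

lemma mat_prod_list_Cons [simp]: "mat_prod_list (M # Ms) = M ** mat_prod_list Ms"
  by (simp add: mat_prod_list_def)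

lemma mat_prod_list_append [simp]:
  "mat_prod_list (Ms @ Ns) = mat_prod_list Ms ** mat_prod_list Ns"
  by (induction Ms) (simp_all add: matrix_mul_assoc)

lemma mat_prod_list_replicate [simp]: "mat_prod_list (replicate k M) = matpow M k"
  by (induction k) simp_all

lemma mat_scale_mult:
  fixes M N :: "'a::comm_semiring_1 ^'n^'n"
  shows "mat_scale c M ** mat_scale d N = mat_scale (c * d) (M ** N)"
  by (simp add: vec_eq_iff matrix_matrix_mult_def mat_scale_def sum_distrib_left ac_simps)

lemma mat_scale_one [simp]: "mat_scale 1 M = M"
  by (simp add: mat_scale_def)

text \<open>A power of a sum is the sum of all noncommutative monomials of that degree, so it suffices to
  bound these. The prefix \<open>P\<close> collects the letters chosen so far in the induction.\<close>

lemma trace_matpow_le: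
  fixes V :: "'l::finite \<Rightarrow> 'a::linordered_idem_semifield ^'n^'n"
  assumes M: "M = (\<Sum>d\<in>UNIV. V d)"
    and "\<And>w. length w = k \<Longrightarrow> trace (P ** mat_prod_list (map V w)) \<le> c"
  shows "trace (P ** matpow M k) \<le> c"
  using assms(2)
proof (induction k arbitrary: P)
  case 0
  then show ?case by (metis list.size(3) list.simps(8) mat_prod_list_Nil matpow.simps(1))
next
  case (Suc k)
  have expand: "trace (P ** (sum V S ** N)) = (\<Sum>d\<in>S. trace (P ** V d ** N))"
    if "finite S" for S N
    using that
  proof induction
    case empty
    show ?case by (simp add: trace_def matrix_matrix_mult_def)
  next
    case (insert d S)
    then show ?case
      by (simp add: trace_add_semiring matrix_add_ldistrib matrix_add_rdistrib_semiring
          matrix_mul_assoc)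
  qed
  have "trace (P ** V d ** matpow M k) \<le> c" for d
  proof (rule Suc.IH)
    fix w :: "'l list"
    assume "length w = k"
    then show "trace (P ** V d ** mat_prod_list (map V w)) \<le> c"
      using Suc.prems[of "d # w"] by (simp add: matrix_mul_assoc)
  qed
  then show ?case
    by (simp add: M expand idem_sum_le_iff)
qed

section \<open>Subeigenvectors\<close>

definition subeigenvector :: "'a::linordered_idem_semifield ^'n^'n \<Rightarrow> 'a \<Rightarrow> 'a ^'n \<Rightarrow> bool" where
  "subeigenvector M c x \<longleftrightarrow> (\<forall>i. (M *v x) $ i \<le> c * x $ i)"

lemma subeigenvector_one_iff: "subeigenvector M 1 x \<longleftrightarrow> M *v x \<le> x"
  by (simp add: subeigenvector_def less_eq_vec_def)

lemma subeigenvector_iff_entries: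
  "subeigenvector M c x \<longleftrightarrow> (\<forall>i j. M $ i $ j * x $ j \<le> c * x $ i)"
  by (simp add: subeigenvector_def matrix_vector_mult_def idem_sum_le_iff)

text \<open>A common subeigenvector of the factors is one of the product, with the product of the factors'
  bounds. This yields the bounds on traces of words without expanding any power of a sum.\<close>

lemma subeigenvector_mult:
  assumes "subeigenvector M c x" "subeigenvector N d x"
  shows "subeigenvector (M ** N) (c * d) x"
  unfolding subeigenvector_def
proof
  fix i
  have "M $ i $ j * (N *v x) $ j \<le> c * d * x $ i" for j
  proof -
    have "M $ i $ j * (N *v x) $ j \<le> M $ i $ j * (d * x $ j)"
      using assms(2) by (simp add: subeigenvector_def mult_left_mono)
    also have "\<dots> = d * (M $ i $ j * x $ j)"
      by (simp add: ac_simps)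
    also have "\<dots> \<le> d * (c * x $ i)"
      using assms(1) by (simp add: subeigenvector_iff_entries mult_left_mono)
    finally show ?thesis
      by (simp add: ac_simps)
  qed
  then have "(M *v (N *v x)) $ i \<le> c * d * x $ i"
    by (simp add: matrix_vector_mult_def[of M] idem_sum_le_iff)
  then show "((M ** N) *v x) $ i \<le> c * d * x $ i"
    by (simp add: matrix_vector_mul_assoc)
qed

lemma subeigenvector_mat_1: "subeigenvector (mat 1) 1 x"
  by (simp add: subeigenvector_def)

lemma subeigenvector_matpow:
  "subeigenvector M c x \<Longrightarrow> subeigenvector (matpow M k) (c ^ k) x"
  by (induction k) (simp_all add: subeigenvector_mat_1 subeigenvector_mult)

lemma subeigenvector_mat_prod_list:
  assumes "\<And>e. e \<in> set es \<Longrightarrow> subeigenvector (F e) (c e) x"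
  shows "subeigenvector (mat_prod_list (map F es)) (prod_list (map c es)) x"
  using assms by (induction es) (simp_all add: subeigenvector_mat_1 subeigenvector_mult)

text \<open>The nonzero entry \<open>x\<^sub>i\<close> cancels from \<open>M\<^sub>i\<^sub>i x\<^sub>i \<le> c x\<^sub>i\<close>.\<close>

lemma subeigenvector_trace_le:
  assumes "subeigenvector M c x" "regular x"
  shows "trace M \<le> c"
proof -
  have "M $ i $ i \<le> c" for i
  proof -
    have "x $ i * M $ i $ i \<le> x $ i * c"
      using assms(1) by (metis subeigenvector_iff_entries mult.commute)
    then show ?thesis
      using assms(2) by (simp add: mult_le_cancel_nonzero regular_def)
  qed
  then show ?thesis
    by (simp add: trace_def idem_sum_le_iff)
qed

text \<open>A sum is bounded as soon as its terms are, and each term \<open>x\<^sub>i\<inverse> (M x)\<^sub>i\<close> can be cleared of its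
  inverse; so a bound on an objective becomes a linear inequality.\<close>

lemma conj_form_le_iff:
  assumes "regular x"
  shows "conj_form x M \<le> c \<longleftrightarrow> subeigenvector M c x"
proof -
  have "conj_form x M \<le> c \<longleftrightarrow> (\<forall>i. inverse (x $ i) * (M *v x) $ i \<le> c)"
    using assms by (simp add: conj_form_def scalar_product_def vec_conj_def regular_def
        idem_sum_le_iff)
  also have "\<dots> \<longleftrightarrow> subeigenvector M c x"
    using assms by (simp add: inverse_mult_le_iff subeigenvector_def regular_def mult.commute)
  finally show ?thesis .
qed


section \<open>Walks and the Kleene star\<close>

fun walk_weight :: "'a::comm_semiring_1 ^'n^'n \<Rightarrow> 'n list \<Rightarrow> 'a" where
  "walk_weight M (u # v # vs) = M $ u $ v * walk_weight M (v # vs)"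
| "walk_weight M _ = 1"

lemma walk_weight_append:
  "walk_weight M (p @ v # q) = walk_weight M (p @ [v]) * walk_weight M (v # q)"
proof (induction p)
  case (Cons a p)
  then show ?case by (cases p) (simp_all add: mult.assoc)
qed simp

lemma walk_weight_excise:
  "walk_weight M (xs @ y # ys @ y # zs) =
    walk_weight M (y # ys @ [y]) * walk_weight M (xs @ y # zs)"
  using walk_weight_append[of M xs y "ys @ y # zs"] walk_weight_append[of M "y # ys" y zs]
    walk_weight_append[of M xs y zs]
  by (simp add: ac_simps)

text \<open>The entries of a power are the largest weights of walks of that length. The factor \<open>d\<close> carries
  the weight of the steps already taken and lets the induction avoid division by it.\<close>

lemma matpow_entry_le_iff:
  fixes M :: "'a::linordered_idem_semifield ^'n^'n"
  shows "d * matpow M k $ i $ j \<le> c \<longleftrightarrow>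
    (\<forall>vs. length vs = Suc k \<and> hd vs = i \<and> last vs = j \<longrightarrow> d * walk_weight M vs \<le> c)"
proof (induction k arbitrary: d i)
  case 0
  have "(\<forall>vs. length vs = Suc 0 \<and> hd vs = i \<and> last vs = j \<longrightarrow> d * walk_weight M vs \<le> c) \<longleftrightarrow>
      (i = j \<longrightarrow> d \<le> c)"
    by (auto simp: length_Suc_conv)
  then show ?case
    by (simp add: mat_def)
next
  case (Suc k)
  have "d * matpow M (Suc k) $ i $ j \<le> c \<longleftrightarrow> (\<forall>v. (d * M $ i $ v) * matpow M k $ v $ j \<le> c)"
    by (simp add: matrix_matrix_mult_def sum_distrib_left idem_sum_le_iff mult.assoc)
  also have "\<dots> \<longleftrightarrow> (\<forall>v vs. length vs = Suc k \<and> hd vs = v \<and> last vs = j \<longrightarrow>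
      d * M $ i $ v * walk_weight M vs \<le> c)"
    by (simp only: Suc.IH)
  also have "\<dots> \<longleftrightarrow> (\<forall>vs. length vs = Suc (Suc k) \<and> hd vs = i \<and> last vs = j \<longrightarrow>
      d * walk_weight M vs \<le> c)"
    (is "?split \<longleftrightarrow> ?whole")
  proof
    assume ?split
    show ?whole
    proof (intro allI impI)
      fix vs
      assume "length vs = Suc (Suc k) \<and> hd vs = i \<and> last vs = j"
      moreover from this obtain v ws where "vs = i # v # ws"
        by (auto simp: length_Suc_conv)
      ultimately show "d * walk_weight M vs \<le> c"
        using \<open>?split\<close>[rule_format, of "v # ws" v] by (simp add: mult.assoc)
    qed
  next
    assume ?whole
    show ?split
    proof (intro allI impI)
      fix v vs
      assume "length vs = Suc k \<and> hd vs = v \<and> last vs = j"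
      moreover from this obtain ws where "vs = v # ws"
        by (auto simp: length_Suc_conv)
      ultimately show "d * M $ i $ v * walk_weight M vs \<le> c"
        using \<open>?whole\<close>[rule_format, of "i # v # ws"] by (simp add: mult.assoc)
    qed
  qed
  finally show ?case .
qed

lemma walk_weight_le_matpow:
  fixes M :: "'a::linordered_idem_semifield ^'n^'n"
  assumes "vs \<noteq> []"
  shows "walk_weight M vs \<le> matpow M (length vs - 1) $ hd vs $ last vs"
  using matpow_entry_le_iff[of 1 M "length vs - 1" "hd vs" "last vs"
      "matpow M (length vs - 1) $ hd vs $ last vs"] assms
  by (cases vs) auto

text \<open>A closed walk on \<open>n\<close> vertices with more than \<open>n\<close> steps meets itself, and hence splits into
  two shorter closed walks. So the bound that \<^const>\<open>Tr\<close> puts on the short closed walks extends to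
  all of them.\<close>

lemma closed_walk_weight_le_1:
  fixes M :: "'a::linordered_idem_semifield ^'n^'n"
  assumes "Tr M \<le> 1" "vs \<noteq> []" "hd vs = last vs"
  shows "walk_weight M vs \<le> 1"
  using assms(2,3)
proof (induction vs rule: length_induct)
  case (1 vs)
  consider "length vs = 1" | "length vs - 1 \<in> {1..CARD('n)}" | "CARD('n) < length vs - 1"
    using 1(2) by (cases "length vs") (auto simp: not_less Suc_le_eq, linarith)
  then show ?case
  proof cases
    case 1
    then show ?thesis by (auto simp: length_Suc_conv)
  next
    case 2
    have "walk_weight M vs \<le> matpow M (length vs - 1) $ hd vs $ hd vs"
      using walk_weight_le_matpow[OF 1(2)] 1(3) by metis
    also have "\<dots> \<le> trace (matpow M (length vs - 1))"
      unfolding trace_def by (rule member_le_sum) simp_all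
    also have "\<dots> \<le> 1"
      using assms(1) 2 by (simp add: Tr_def idem_sum_le_iff)
    finally show ?thesis .
  next
    case 3
    have "\<not> distinct (butlast vs)"
    proof
      assume "distinct (butlast vs)"
      then have "length (butlast vs) \<le> CARD('n)"
        by (metis card_mono distinct_card finite_class.finite_UNIV top_greatest)
      with 3 show False by simp
    qed
    then obtain xs y ys zs where "butlast vs = xs @ [y] @ ys @ [y] @ zs"
      using not_distinct_decomp by blast
    then have vs: "vs = xs @ y # ys @ y # zs @ [last vs]"
      using append_butlast_last_id[OF 1(2)] by simp
    define l where "l = last vs"
    have eq: "vs = xs @ y # ys @ y # (zs @ [l])"
      using vs by (simp add: l_def)
    have "hd (xs @ y # zs @ [l]) = hd vs"
      by (subst eq, cases xs) simp_all
    then have "hd (xs @ y # zs @ [l]) = l"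
      using 1(3) l_def by simp
    then have "walk_weight M (xs @ y # zs @ [l]) \<le> 1"
      using 1(1) by (simp add: eq)
    moreover have "walk_weight M (y # ys @ [y]) \<le> 1"
      using 1(1) by (simp add: eq)
    ultimately show ?thesis
      unfolding eq walk_weight_excise using idem_mult_mono by fastforce
  qed
qed

text \<open>Cutting out a closed piece of weight at most \<open>\<one>\<close> shortens a walk without lowering its weight.\<close>

lemma distinct_walk_exists:
  fixes M :: "'a::linordered_idem_semifield ^'n^'n"
  assumes "Tr M \<le> 1" "vs \<noteq> []"
  shows "\<exists>ws. ws \<noteq> [] \<and> distinct ws \<and> hd ws = hd vs \<and> last ws = last vs \<and>
    walk_weight M vs \<le> walk_weight M ws"
  using assms(2)
proof (induction vs rule: length_induct)
  case (1 vs)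
  show ?case
  proof (cases "distinct vs")
    case False
    then obtain xs y ys zs where eq: "vs = xs @ y # ys @ y # zs"
      using not_distinct_decomp by fastforce
    have "walk_weight M (y # ys @ [y]) \<le> 1"
      by (rule closed_walk_weight_le_1[OF assms(1)]) simp_all
    then have "walk_weight M vs \<le> walk_weight M (xs @ y # zs)"
      unfolding eq walk_weight_excise using idem_mult_mono by fastforce
    moreover obtain ws where "ws \<noteq> []" "distinct ws" "hd ws = hd (xs @ y # zs)"
      "last ws = last (xs @ y # zs)" "walk_weight M (xs @ y # zs) \<le> walk_weight M ws"
      using 1(1)[rule_format, of "xs @ y # zs"] eq by auto
    moreover have "hd (xs @ y # zs) = hd vs" "last (xs @ y # zs) = last vs"
      by (cases xs; simp add: eq)+
    ultimately show ?thesis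
      by (metis order_trans)
  qed (use 1(2) in auto)
qed

lemma kleene_star_entry:
  fixes M :: "'a::linordered_idem_semifield ^'n^'n"
  assumes "Tr M \<le> 1"
  shows "kleene_star M $ i $ j = (\<Sum>k = 0..CARD('n) - 1. matpow M k $ i $ j)"
  using assms by (simp add: kleene_star_def)

text \<open>Every walk can be replaced by one without repeated vertices, which has at most \<open>n - 1\<close> steps;
  so the star loses nothing by stopping at the power \<open>n - 1\<close>.\<close>

lemma matpow_le_kleene_star:
  fixes M :: "'a::linordered_idem_semifield ^'n^'n"
  assumes "Tr M \<le> 1"
  shows "matpow M k $ i $ j \<le> kleene_star M $ i $ j"
proof -
  have "1 * walk_weight M vs \<le> kleene_star M $ i $ j"
    if vs: "length vs = Suc k \<and> hd vs = i \<and> last vs = j" for vs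
  proof -
    obtain ws where ws: "ws \<noteq> []" "distinct ws" "hd ws = i" "last ws = j"
      "walk_weight M vs \<le> walk_weight M ws"
      using distinct_walk_exists[OF assms, of vs] vs by force
    have "length ws \<le> CARD('n)"
      using ws(2) by (metis card_mono distinct_card finite_class.finite_UNIV top_greatest)
    then have "length ws - 1 \<in> {0..CARD('n) - 1}"
      by simp
    then have "matpow M (length ws - 1) $ i $ j \<le> kleene_star M $ i $ j"
      unfolding kleene_star_entry[OF assms] by (rule member_le_sum) simp_all
    moreover have "walk_weight M ws \<le> matpow M (length ws - 1) $ i $ j"
      using walk_weight_le_matpow[OF ws(1), of M] ws(3,4) by simp
    ultimately have "walk_weight M ws \<le> kleene_star M $ i $ j"
      by (rule order_trans[rotated])
    with ws(5) show ?thesis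
      by (simp add: order_trans[OF ws(5)])
  qed
  then show ?thesis
    using matpow_entry_le_iff[of 1 M k i j "kleene_star M $ i $ j"] by simp
qed

lemma le_kleene_star_mult:
  fixes M :: "'a::linordered_idem_semifield ^'n^'n"
  assumes "Tr M \<le> 1"
  shows "u \<le> kleene_star M *v u"
  unfolding less_eq_vec_def
proof
  fix i
  have "1 \<le> kleene_star M $ i $ i"
    using matpow_le_kleene_star[OF assms, of 0 i i] by (simp add: mat_def)
  then have "1 * u $ i \<le> kleene_star M $ i $ i * u $ i"
    by (rule idem_mult_mono) simp
  also have "\<dots> \<le> (kleene_star M *v u) $ i"
    by (simp add: matrix_vector_mult_def)
      (rule member_le_sum[where f = "\<lambda>j. kleene_star M $ i $ j * u $ j"]; simp)
  finally show "u $ i \<le> (kleene_star M *v u) $ i"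
    by simp
qed

lemma mult_kleene_star_le:
  fixes M :: "'a::linordered_idem_semifield ^'n^'n"
  assumes "Tr M \<le> 1"
  shows "M *v (kleene_star M *v u) \<le> kleene_star M *v u"
proof -
  have "M $ i $ v * (matpow M k $ v $ j * u $ j) \<le> (kleene_star M *v u) $ i" for i v j k
  proof -
    have "M $ i $ v * matpow M k $ v $ j \<le> matpow M (Suc k) $ i $ j"
      by (simp add: matrix_matrix_mult_def)
        (rule member_le_sum[where f = "\<lambda>v. M $ i $ v * matpow M k $ v $ j"]; simp)
    also have "\<dots> \<le> kleene_star M $ i $ j"
      by (rule matpow_le_kleene_star[OF assms])
    finally have "M $ i $ v * matpow M k $ v $ j * u $ j \<le> kleene_star M $ i $ j * u $ j"
      by (rule idem_mult_mono) simp
    also have "\<dots> \<le> (kleene_star M *v u) $ i"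
      by (simp add: matrix_vector_mult_def)
        (rule member_le_sum[where f = "\<lambda>j. kleene_star M $ i $ j * u $ j"]; simp)
    finally show ?thesis
      by (simp add: mult.assoc)
  qed
  then show ?thesis
    by (simp add: less_eq_vec_def matrix_vector_mult_def[of M] idem_sum_le_iff
        matrix_vector_mult_def[of "kleene_star M" u] kleene_star_entry[OF assms]
        sum_distrib_left sum_distrib_right)
qed

lemma kleene_star_fixes_solution:
  fixes M :: "'a::linordered_idem_semifield ^'n^'n"
  assumes "Tr M \<le> 1" "M *v x \<le> x"
  shows "kleene_star M *v x = x"
proof -
  have "matpow M k $ i $ j * x $ j \<le> x $ i" for k i j
    using subeigenvector_matpow[of M 1 x k] assms(2)
    by (simp add: subeigenvector_one_iff[symmetric]) (simp add: subeigenvector_iff_entries)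
  then have "(kleene_star M *v x) $ i \<le> x $ i" for i
    by (simp add: matrix_vector_mult_def kleene_star_entry[OF assms(1)] sum_distrib_right
        idem_sum_le_iff)
  with le_kleene_star_mult[OF assms(1), of x] show ?thesis
    by (simp add: vec_eq_iff less_eq_vec_def order_antisym)
qed

section \<open>Cyclic words in three matrices\<close>

text \<open>A word stands for a product of the matrices \<open>A\<close>, \<open>B\<close>, \<open>C\<close> in a given order. Working with
  letters rather than with the matrices keeps the multiplicities meaningful even if some of the three
  matrices coincide.\<close>

datatype letter = LA | LB | LC

lemma UNIV_letter: "UNIV = {LA, LB, LC}"
  using letter.exhaust by auto

instance letter :: finite
  by standard (simp add: UNIV_letter)

definition word_matrix ::
  "'a::semiring_1 ^'n^'n \<Rightarrow> 'a ^'n^'n \<Rightarrow> 'a ^'n^'n \<Rightarrow> letter list \<Rightarrow> 'a ^'n^'n" where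
  "word_matrix A B C w = mat_prod_list (map (case_letter A B C) w)"

lemma word_matrix_append: "word_matrix A B C (v @ w) = word_matrix A B C v ** word_matrix A B C w"
  by (simp add: word_matrix_def)

lemma length_eq_count_letters:
  "length w = count_list w LA + count_list w LB + count_list w LC"
proof (induction w)
  case (Cons d w)
  then show ?case by (cases d) simp_all
qed simp

lemma word_matrix_scale:
  fixes A B C :: "'a::comm_semiring_1 ^'n^'n"
  shows "word_matrix (mat_scale a A) (mat_scale b B) C w =
    mat_scale (a ^ count_list w LA * b ^ count_list w LB) (word_matrix A B C w)"
proof (induction w)
  case (Cons d w)
  then show ?case
    using mat_scale_mult[of 1 C]
    by (cases d) (simp_all add: word_matrix_def mat_scale_mult ac_simps)
qed (simp add: word_matrix_def)

lemma word_matrix_single_letter: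
  assumes "set w \<subseteq> {d}"
  shows "word_matrix A B C w = matpow (case_letter A B C d) (length w)"
proof -
  have "w = replicate (length w) d"
    using assms by (metis replicate_eqI singletonD subsetD)
  then show ?thesis
    by (metis word_matrix_def map_replicate mat_prod_list_replicate)
qed

definition block_product :: "'a::semiring_1 ^'n^'n \<Rightarrow> 'a ^'n^'n \<Rightarrow> 'a ^'n^'n \<Rightarrow>
    nat list \<Rightarrow> nat list \<Rightarrow> 'a ^'n^'n" where
  "block_product A B C is js =
    mat_prod_list (map2 (\<lambda>i j. matpow A i ** matpow B j ** matpow C (1 - j)) is js)"

lemma block_product_Nil [simp]: "block_product A B C [] [] = mat 1"
  by (simp add: block_product_def)

lemma block_product_Cons [simp]:
  "block_product A B C (i # is) (j # js) =
    matpow A i ** matpow B j ** matpow C (1 - j) ** block_product A B C is js"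
  by (simp add: block_product_def)

text \<open>Each letter other than \<open>A\<close> closes a block, which consists of the \<open>A\<close>s before it and itself. The
  last letter must not be \<open>A\<close>, for otherwise an unclosed block remains.\<close>

lemma block_decomposition:
  assumes "w = [] \<or> last w \<noteq> LA"
  shows "\<exists>is js. length is = length js \<and> length w = sum_list is + length is \<and>
    sum_list is = count_list w LA \<and> sum_list js = count_list w LB \<and> set js \<subseteq> {0, 1} \<and>
    word_matrix A B C w = block_product A B C is js"
  using assms
proof (induction w)
  case Nil
  show ?case by (intro exI[of _ "[]"]) (simp add: word_matrix_def)
next
  case (Cons d w)
  have tail: "w = [] \<or> last w \<noteq> LA"
    using Cons.prems by (cases w) simp_all
  obtain "is" js where IH: "length is = length js" "length w = sum_list is + length is"
    "sum_list is = count_list w LA" "sum_list js = count_list w LB" "set js \<subseteq> {0, 1}"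
    "word_matrix A B C w = block_product A B C is js"
    using Cons.IH[OF tail] by (elim exE conjE)
  show ?case
  proof (cases d)
    case LA
    with Cons.prems have "w \<noteq> []"
      by auto
    with IH(1,2) obtain i is' j js' where "is = i # is'" "js = j # js'"
      by (cases "is"; cases js) auto
    with IH LA show ?thesis
      by (intro exI[of _ "Suc i # is'"] exI[of _ js])
        (simp add: word_matrix_def matrix_mul_assoc)
  next
    case LB
    with IH show ?thesis
      by (intro exI[of _ "0 # is"] exI[of _ "1 # js"]) (simp add: word_matrix_def)
  next
    case LC
    with IH show ?thesis
      by (intro exI[of _ "0 # is"] exI[of _ "0 # js"]) (simp add: word_matrix_def)
  qed
qed

text \<open>The trace does not change under cyclic rotation, so a word with a letter other than \<open>A\<close> may be
  assumed to end in such a letter, and then it splits into blocks.\<close>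

lemma trace_word_blocks:
  fixes A B C :: "'a::comm_semiring_1 ^'n^'n"
  assumes "count_list w LA < length w"
  shows "\<exists>is js. is \<in> multi_indices (length w - count_list w LA) (count_list w LA) \<and>
    js \<in> binary_multi_indices (length w - count_list w LA) (count_list w LB) \<and>
    trace (word_matrix A B C w) = trace (block_product A B C is js)"
proof -
  have "\<exists>d\<in>set w. d \<noteq> LA"
  proof (rule ccontr)
    assume "\<not> (\<exists>d\<in>set w. d \<noteq> LA)"
    then have "w = replicate (length w) LA"
      by (metis replicate_eqI)
    then have "count_list w LA = length w"
      by (induction w) auto
    with assms show False
      by simp
  qed
  then obtain d u v where w: "w = u @ d # v" and d: "d \<noteq> LA"
    by (metis split_list)
  define w' where "w' = v @ u @ [d]"
  have rot: "trace (word_matrix A B C w) = trace (word_matrix A B C w')"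
    using trace_mult_commute[of "word_matrix A B C (u @ [d])" "word_matrix A B C v"]
    by (simp add: w w'_def flip: word_matrix_append)
  have counts: "count_list w' c = count_list w c" "length w' = length w" for c
    by (auto simp: w w'_def)
  obtain "is" js where "length is = length js" "length w' = sum_list is + length is"
    "sum_list is = count_list w' LA" "sum_list js = count_list w' LB" "set js \<subseteq> {0, 1}"
    "word_matrix A B C w' =
      block_product A B C is js"
    using block_decomposition[of w' A B C] d by (auto simp: w'_def)
  then show ?thesis
    unfolding rot
    by (intro exI[of _ "is"] exI[of _ js]) (auto simp: counts multi_indices_def
        binary_multi_indices_def)
qed

lemma r_coeff_le_iff:
  "r_coeff A B C k l m \<le> c \<longleftrightarrow> (\<forall>is\<in>multi_indices k m. \<forall>js\<in>binary_multi_indices k l.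
    trace (block_product A B C is js) \<le> c)"
  by (simp add: r_coeff_def block_product_def idem_sum_le_iff finite_multi_indices
      finite_binary_multi_indices)

lemma trace_word_le_r_coeff:
  fixes A B C :: "'a::linordered_idem_semifield ^'n^'n"
  assumes "count_list w LA < length w"
  shows "trace (word_matrix A B C w) \<le>
    r_coeff A B C (length w - count_list w LA) (count_list w LB) (count_list w LA)"
proof -
  obtain "is" js where idx: "is \<in> multi_indices (length w - count_list w LA) (count_list w LA)"
    "js \<in> binary_multi_indices (length w - count_list w LA) (count_list w LB)"
    and eq: "trace (word_matrix A B C w) = trace (block_product A B C is js)"
    using trace_word_blocks[OF assms] by blast
  have "r_coeff A B C (length w - count_list w LA) (count_list w LB) (count_list w LA) \<le> c \<Longrightarrow>
      trace (word_matrix A B C w) \<le> c" for c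
    using idx unfolding eq
    by (simp add: r_coeff_le_iff)
  then show ?thesis
    by blast
qed

lemma mixed_radius_le_iff:
  fixes A C :: "'a::radicable_semifield ^'n^'n"
  shows "mixed_radius A C \<le> c \<longleftrightarrow>
    (\<forall>k\<in>{1..CARD('n) - 1}. \<forall>m\<in>{1..CARD('n) - k}. \<forall>is\<in>multi_indices k m.
      trace (mat_prod_list (map (\<lambda>i. matpow A i ** C) is)) \<le> c ^ m)"
  by (simp add: mixed_radius_def idem_sum_le_iff finite_multi_indices powq_root_le_iff)

lemma spectral_radius_le_iff:
  fixes A :: "'a::radicable_semifield ^'n^'n"
  shows "spectral_radius A \<le> c \<longleftrightarrow> (\<forall>k\<in>{1..CARD('n)}. trace (matpow A k) \<le> c ^ k)"
  by (simp add: spectral_radius_def idem_sum_le_iff powq_root_le_iff)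

lemma map2_zeros:
  "length is = length js \<Longrightarrow> sum_list js = (0::nat) \<Longrightarrow> map2 f is js = map (\<lambda>i. f i 0) is"
  by (induction "is" js rule: list_induct2) auto

lemma trace_word_le_mixed_radius:
  fixes A B C :: "'a::radicable_semifield ^'n^'n"
  assumes "count_list w LB = 0" "0 < count_list w LA" "count_list w LA < length w"
    and "length w \<le> CARD('n)" "mixed_radius A C \<le> c"
  shows "trace (word_matrix A B C w) \<le> c ^ count_list w LA"
proof -
  define k m where "k = length w - count_list w LA" and "m = count_list w LA"
  obtain "is" js where idx: "is \<in> multi_indices k m" "js \<in> binary_multi_indices k 0"
    and "trace (word_matrix A B C w) = trace (block_product A B C is js)"
    using trace_word_blocks[OF assms(3), of A B C] assms(1) by (auto simp: k_def m_def)
  moreover have "block_product A B C is js = mat_prod_list (map (\<lambda>i. matpow A i ** C) is)"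
    unfolding block_product_def using idx
    by (subst map2_zeros) (simp_all add: multi_indices_def binary_multi_indices_def)
  moreover have "k \<in> {1..CARD('n) - 1}" "m \<in> {1..CARD('n) - k}"
    using assms(2-4) by (auto simp: k_def m_def)
  ultimately show ?thesis
    using assms(5) by (simp add: mixed_radius_le_iff flip: m_def)
qed

text \<open>Exchanging the roles of \<open>A\<close> and \<open>B\<close> carries the bound on words in \<open>A\<close> and \<open>C\<close> over to words
  in \<open>B\<close> and \<open>C\<close>.\<close>

lemma word_matrix_swap:
  "word_matrix A B C w = word_matrix B A C (map (case_letter LB LA LC) w)"
proof -
  have "case_letter A B C = case_letter B A C \<circ> case_letter LB LA LC"
    by (rule ext) (simp split: letter.split)
  then show ?thesis
    by (simp add: word_matrix_def)
qed

lemma count_list_swap: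
  "count_list (map (case_letter LB LA LC) w) LA = count_list w LB"
  "count_list (map (case_letter LB LA LC) w) LB = count_list w LA"
  by (induction w) (auto split: letter.splits)


section \<open>Attainable pairs of bounds\<close>

text \<open>The conditions on \<open>r_coeff\<close> are those of \<open>G(\<alpha>) \<le> \<beta>\<close>, cleared of roots and inverses, so
  that \<open>\<alpha>\<close> and \<open>\<beta>\<close> play symmetric roles.\<close>

definition admissible ::
  "'a::radicable_semifield ^'n^'n \<Rightarrow> 'a ^'n^'n \<Rightarrow> 'a ^'n^'n \<Rightarrow> 'a \<Rightarrow> 'a \<Rightarrow> bool" where
  "admissible A B C \<alpha> \<beta> \<longleftrightarrow>
    spectral_radius A + mixed_radius A C \<le> \<alpha> \<and> spectral_radius B + mixed_radius B C \<le> \<beta> \<and>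
    (\<forall>k\<in>{1..CARD('n) - 1}. \<forall>m\<in>{1..CARD('n) - k}. \<forall>l\<in>{1..k}.
      r_coeff A B C k l m \<le> \<alpha> ^ m * \<beta> ^ l)"

text \<open>Every word belongs to one of six kinds, according to the letters that occur in it, and each
  kind is controlled by one of the defining inequalities or by \<open>Tr C \<le> \<one>\<close>.\<close>

lemma admissible_word_bound:
  fixes A B C :: "'a::radicable_semifield ^'n^'n"
  assumes adm: "admissible A B C \<alpha> \<beta>" and "Tr C \<le> 1"
    and len: "1 \<le> length w" "length w \<le> CARD('n)"
  shows "trace (word_matrix A B C w) \<le> \<alpha> ^ count_list w LA * \<beta> ^ count_list w LB"
proof -
  have rad: "spectral_radius A \<le> \<alpha>" "mixed_radius A C \<le> \<alpha>" "spectral_radius B \<le> \<beta>"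
    "mixed_radius B C \<le> \<beta>"
    using adm by (simp_all add: admissible_def idem_add_le_iff)
  note lsum = length_eq_count_letters[of w]
  have single: "set w \<subseteq> {d}" if "count_list w d = length w" for d
  proof -
    have "x = d" if "x \<in> set w" for x
    proof (rule ccontr)
      assume "x \<noteq> d"
      have "count_list w x \<noteq> 0"
        using that by (metis count_list_0_iff)
      moreover have "count_list w x + count_list w d \<le> length w"
        using lsum \<open>x \<noteq> d\<close> by (cases x; cases d) auto
      ultimately show False
        using \<open>count_list w d = length w\<close> by simp
    qed
    then show ?thesis by blast
  qed
  \<comment> \<open>If both \<open>A\<close> and \<open>B\<close> occur, \<open>C\<close> may be present or absent: \<open>r_coeff\<close> covers both.\<close>
  consider (A) "count_list w LA = length w" | (B) "count_list w LB = length w"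
    | (C) "count_list w LC = length w"
    | (AC) "count_list w LB = 0" "0 < count_list w LA" "count_list w LA < length w"
    | (BC) "count_list w LA = 0" "0 < count_list w LB" "count_list w LB < length w"
    | (AB) "0 < count_list w LA" "0 < count_list w LB"
    using lsum by linarith
  then show ?thesis
  proof cases
    case A
    then have "trace (word_matrix A B C w) \<le> \<alpha> ^ length w" "count_list w LB = 0"
      using rad(1) len lsum
      by (simp_all add: word_matrix_single_letter[OF single] spectral_radius_le_iff)
    with A show ?thesis by simp
  next
    case B
    then have "trace (word_matrix A B C w) \<le> \<beta> ^ length w" "count_list w LA = 0"
      using rad(3) len lsum
      by (simp_all add: word_matrix_single_letter[OF single] spectral_radius_le_iff)
    with B show ?thesis by simp
  next
    case C
    then have "trace (word_matrix A B C w) \<le> 1" "count_list w LA = 0" "count_list w LB = 0"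
      using \<open>Tr C \<le> 1\<close> len lsum
      by (simp_all add: word_matrix_single_letter[OF single] Tr_def idem_sum_le_iff)
    then show ?thesis by simp
  next
    case AC
    then show ?thesis
      using trace_word_le_mixed_radius[OF AC len(2) rad(2)] by simp
  next
    case BC
    then show ?thesis
      using trace_word_le_mixed_radius[of "map (case_letter LB LA LC) w" B C \<beta> A] len rad(4)
      by (simp add: count_list_swap word_matrix_swap[of A B])
  next
    case AB
    define k where "k = length w - count_list w LA"
    have "trace (word_matrix A B C w) \<le> r_coeff A B C k (count_list w LB) (count_list w LA)"
      using AB lsum unfolding k_def by (intro trace_word_le_r_coeff) linarith
    also have "k \<in> {1..CARD('n) - 1}" "count_list w LA \<in> {1..CARD('n) - k}"
        "count_list w LB \<in> {1..k}"
      using AB lsum len by (auto simp: k_def)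
    then have "r_coeff A B C k (count_list w LB) (count_list w LA) \<le>
        \<alpha> ^ count_list w LA * \<beta> ^ count_list w LB"
      using adm by (simp add: admissible_def)
    finally show ?thesis .
  qed
qed

text \<open>In a monomial of the power, the scalars \<open>\<alpha>\<inverse>\<close> and \<open>\<beta>\<inverse>\<close> cancel the bound on the word.\<close>

lemma Tr_le_1_if_admissible:
  fixes A B C :: "'a::radicable_semifield ^'n^'n"
  assumes "admissible A B C \<alpha> \<beta>" "Tr C \<le> 1" "\<alpha> \<noteq> 0" "\<beta> \<noteq> 0"
  shows "Tr (mat_scale (inverse \<alpha>) A + mat_scale (inverse \<beta>) B + C) \<le> 1"
proof -
  define V where "V = case_letter (mat_scale (inverse \<alpha>) A) (mat_scale (inverse \<beta>) B) C"
  define M where "M = mat_scale (inverse \<alpha>) A + mat_scale (inverse \<beta>) B + C"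
  have M: "M = (\<Sum>d\<in>UNIV. V d)"
    by (simp add: UNIV_letter V_def M_def add.assoc)
  have "trace (matpow M k) \<le> 1" if k: "k \<in> {1..CARD('n)}" for k
  proof -
    have "trace (mat 1 ** mat_prod_list (map V w)) \<le> 1" if w: "length w = k" for w
    proof -
      define a b where "a = count_list w LA" and "b = count_list w LB"
      have "mat_prod_list (map V w) =
          mat_scale (inverse \<alpha> ^ a * inverse \<beta> ^ b) (word_matrix A B C w)"
        unfolding a_def b_def word_matrix_scale[symmetric] by (simp add: V_def word_matrix_def)
      then have "trace (mat 1 ** mat_prod_list (map V w)) =
          inverse \<alpha> ^ a * inverse \<beta> ^ b * trace (word_matrix A B C w)"
        by (simp add: trace_mat_scale)
      also have "\<dots> \<le> inverse \<alpha> ^ a * inverse \<beta> ^ b * (\<alpha> ^ a * \<beta> ^ b)"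
        using admissible_word_bound[OF assms(1,2), of w] k w
        by (intro mult_left_mono) (simp_all add: a_def b_def)
      also have "\<dots> = (inverse \<alpha> ^ a * \<alpha> ^ a) * (inverse \<beta> ^ b * \<beta> ^ b)"
        by (simp add: ac_simps)
      also have "\<dots> = 1"
        using assms(3,4) by (simp add: inverse_power_mult)
      finally show ?thesis .
    qed
    then have "trace (mat 1 ** matpow M k) \<le> 1"
      by (rule trace_matpow_le[OF M])
    then show ?thesis
      by simp
  qed
  then show ?thesis
    by (simp add: Tr_def idem_sum_le_iff flip: M_def)
qed

lemma prod_list_powers:
  fixes a :: "'a::comm_monoid_mult"
  shows "prod_list (map (\<lambda>i. a ^ i) is) = a ^ sum_list is"
  by (induction "is") (simp_all add: power_add)

lemma prod_list_map2_powers: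
  fixes a b :: "'a::comm_monoid_mult"
  assumes "length is = length js"
  shows "prod_list (map (\<lambda>(i, j). a ^ i * b ^ j) (zip is js)) = a ^ sum_list is * b ^ sum_list js"
  using assms by (induction "is" js rule: list_induct2) (simp_all add: power_add ac_simps)

lemma mixed_radius_le_if_subeigenvector:
  fixes A C :: "'a::radicable_semifield ^'n^'n"
  assumes "regular x" "subeigenvector A \<alpha> x" "subeigenvector C 1 x"
  shows "mixed_radius A C \<le> \<alpha>"
proof -
  have "subeigenvector (matpow A i ** C) (\<alpha> ^ i) x" for i
    using subeigenvector_mult[OF subeigenvector_matpow[OF assms(2)] assms(3)] by simp
  then have "subeigenvector (mat_prod_list (map (\<lambda>i. matpow A i ** C) is))
      (prod_list (map (\<lambda>i. \<alpha> ^ i) is)) x" for "is"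
    by (rule subeigenvector_mat_prod_list)
  then have "trace (mat_prod_list (map (\<lambda>i. matpow A i ** C) is)) \<le> \<alpha> ^ sum_list is" for "is"
    unfolding prod_list_powers using subeigenvector_trace_le assms(1) by blast
  then show ?thesis
    unfolding mixed_radius_le_iff by (auto simp: multi_indices_def)
qed

lemma spectral_radius_le_if_subeigenvector:
  fixes A :: "'a::radicable_semifield ^'n^'n"
  assumes "regular x" "subeigenvector A \<alpha> x"
  shows "spectral_radius A \<le> \<alpha>"
  using subeigenvector_trace_le[OF subeigenvector_matpow[OF assms(2)] assms(1)]
  by (simp add: spectral_radius_le_iff)

lemma r_coeff_le_if_subeigenvector:
  fixes A B C :: "'a::radicable_semifield ^'n^'n"
  assumes "regular x" "subeigenvector A \<alpha> x" "subeigenvector B \<beta> x" "subeigenvector C 1 x"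
  shows "r_coeff A B C k l m \<le> \<alpha> ^ m * \<beta> ^ l"
proof -
  have sub: "subeigenvector (matpow A i ** matpow B j ** matpow C (1 - j)) (\<alpha> ^ i * \<beta> ^ j) x" for i j
    using subeigenvector_mult[OF subeigenvector_mult[OF subeigenvector_matpow[OF assms(2)]
          subeigenvector_matpow[OF assms(3)]] subeigenvector_matpow[OF assms(4)]] by simp
  have "trace (block_product A B C is js)
      \<le> \<alpha> ^ m * \<beta> ^ l"
    if "is \<in> multi_indices k m" "js \<in> binary_multi_indices k l" for "is" js
  proof -
    have "subeigenvector (block_product A B C is js)
        (prod_list (map (\<lambda>(i, j). \<alpha> ^ i * \<beta> ^ j) (zip is js))) x"
      unfolding block_product_def by (rule subeigenvector_mat_prod_list) (use sub in auto)
    then show ?thesis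
      using that subeigenvector_trace_le[OF _ assms(1)]
      by (simp add: prod_list_map2_powers multi_indices_def binary_multi_indices_def)
  qed
  then show ?thesis
    by (simp add: r_coeff_le_iff)
qed

text \<open>A feasible vector is a common subeigenvector of \<open>A\<close>, \<open>B\<close>, \<open>C\<close>, with its objective values and
  \<open>\<one>\<close> as the bounds.\<close>

lemma feasible_admissible:
  fixes A B C :: "'a::radicable_semifield ^'n^'n"
  assumes "feasible C x"
  shows "admissible A B C (conj_form x A) (conj_form x B)"
proof -
  have reg: "regular x" and C: "subeigenvector C 1 x"
    using assms by (simp_all add: feasible_def subeigenvector_one_iff)
  have AB: "subeigenvector A (conj_form x A) x" "subeigenvector B (conj_form x B) x"
    by (simp_all flip: conj_form_le_iff[OF reg])
  show ?thesis
    unfolding admissible_def idem_add_le_iff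
    using reg AB C by (auto intro: spectral_radius_le_if_subeigenvector
        mixed_radius_le_if_subeigenvector r_coeff_le_if_subeigenvector)
qed

lemma feasible_bounds_iff:
  fixes A B C :: "'a::radicable_semifield ^'n^'n"
  assumes "\<alpha> \<noteq> 0" "\<beta> \<noteq> 0" "regular x"
  shows "(mat_scale (inverse \<alpha>) A + mat_scale (inverse \<beta>) B + C) *v x \<le> x \<longleftrightarrow>
    feasible C x \<and> conj_form x A \<le> \<alpha> \<and> conj_form x B \<le> \<beta>"
proof -
  have scale: "mat_scale (inverse c) M *v x \<le> x \<longleftrightarrow> subeigenvector M c x"
    if "c \<noteq> 0" for c and M :: "'a ^'n^'n"
    using that by (simp add: subeigenvector_iff_entries mat_scale_def mult.assoc
        inverse_mult_le_iff flip: subeigenvector_one_iff)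
  have "(M + N) *v x \<le> x \<longleftrightarrow> M *v x \<le> x \<and> N *v x \<le> x" for M N :: "'a ^'n^'n"
    by (auto simp: matrix_vector_mult_add_rdistrib less_eq_vec_def idem_add_le_iff)
  then show ?thesis
    using assms by (auto simp: scale conj_form_le_iff feasible_def)
qed


section \<open>The Pareto frontier\<close>

definition minimal_admissible ::
  "'a::radicable_semifield ^'n^'n \<Rightarrow> 'a ^'n^'n \<Rightarrow> 'a ^'n^'n \<Rightarrow> 'a \<Rightarrow> 'a \<Rightarrow> bool" where
  "minimal_admissible A B C \<alpha> \<beta> \<longleftrightarrow> admissible A B C \<alpha> \<beta> \<and>
    (\<forall>\<alpha>' \<beta>'. admissible A B C \<alpha>' \<beta>' \<and> \<alpha>' \<le> \<alpha> \<and> \<beta>' \<le> \<beta> \<longrightarrow> \<alpha>' = \<alpha> \<and> \<beta>' = \<beta>)"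

lemma G_fun_le_iff:
  fixes A B C :: "'a::radicable_semifield ^'n^'n"
  assumes "\<alpha> \<noteq> 0"
  shows "G_fun A B C \<alpha> \<le> \<beta> \<longleftrightarrow> (\<forall>k\<in>{1..CARD('n) - 1}. \<forall>m\<in>{1..CARD('n) - k}. \<forall>l\<in>{1..k}.
    r_coeff A B C k l m \<le> \<alpha> ^ m * \<beta> ^ l)"
  using assms by (simp add: G_fun_def idem_sum_le_iff powq_term_le_iff)

lemma H_fun_le_iff:
  fixes A B C :: "'a::radicable_semifield ^'n^'n"
  assumes "\<beta> \<noteq> 0"
  shows "H_fun A B C \<beta> \<le> \<alpha> \<longleftrightarrow> (\<forall>k\<in>{1..CARD('n) - 1}. \<forall>m\<in>{1..CARD('n) - k}. \<forall>l\<in>{1..k}.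
    r_coeff A B C k l m \<le> \<beta> ^ l * \<alpha> ^ m)"
  using assms by (simp add: H_fun_def idem_sum_le_iff powq_term_le_iff)

text \<open>A linearly ordered sum equals one of its terms, so at each point of the curve \<open>\<beta> = G(\<alpha>)\<close>
  one of the inequalities \<open>r\<^sub>k\<^sub>l\<^sub>m \<le> \<alpha>\<^sup>m \<beta>\<^sup>l\<close> is tight. A zero value of \<open>G\<close> is excluded because it may be
  that of an empty sum.\<close>

lemma G_fun_attained:
  fixes A B C :: "'a::radicable_semifield ^'n^'n"
  assumes "\<alpha> \<noteq> 0" "G_fun A B C \<alpha> \<noteq> 0"
  obtains k m l where "k \<in> {1..CARD('n) - 1}" "m \<in> {1..CARD('n) - k}" "l \<in> {1..k}"
    "r_coeff A B C k l m = \<alpha> ^ m * G_fun A B C \<alpha> ^ l"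
proof -
  define g where "g k m l =
    r_coeff A B C k l m powq (1 / of_nat l) * \<alpha> powq (- (of_nat m / of_nat l))" for k m l
  have G: "G_fun A B C \<alpha> = (\<Sum>k = 1..CARD('n) - 1. \<Sum>m = 1..CARD('n) - k. \<Sum>l = 1..k. g k m l)"
    by (simp add: G_fun_def g_def)
  obtain k where k: "k \<in> {1..CARD('n) - 1}"
    "(\<Sum>m = 1..CARD('n) - k. \<Sum>l = 1..k. g k m l) = G_fun A B C \<alpha>"
    using idem_sum_attained assms(2) unfolding G by meson
  obtain m where m: "m \<in> {1..CARD('n) - k}" "(\<Sum>l = 1..k. g k m l) = G_fun A B C \<alpha>"
    using idem_sum_attained[of "\<lambda>m. \<Sum>l = 1..k. g k m l" "{1..CARD('n) - k}"] assms(2)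
    unfolding k(2) by blast
  obtain l where l: "l \<in> {1..k}" "g k m l = G_fun A B C \<alpha>"
    using idem_sum_attained[of "g k m" "{1..k}"] assms(2) unfolding m(2) by blast
  show thesis
    using powq_term_eq_imp[OF _ assms(1)] l k(1) m(1) by (intro that) (auto simp: g_def)
qed

lemma H_fun_attained:
  fixes A B C :: "'a::radicable_semifield ^'n^'n"
  assumes "\<beta> \<noteq> 0" "H_fun A B C \<beta> \<noteq> 0"
  obtains k m l where "k \<in> {1..CARD('n) - 1}" "m \<in> {1..CARD('n) - k}" "l \<in> {1..k}"
    "r_coeff A B C k l m = \<beta> ^ l * H_fun A B C \<beta> ^ m"
proof -
  define h where "h k m l =
    r_coeff A B C k l m powq (1 / of_nat m) * \<beta> powq (- (of_nat l / of_nat m))" for k m l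
  have H: "H_fun A B C \<beta> = (\<Sum>k = 1..CARD('n) - 1. \<Sum>m = 1..CARD('n) - k. \<Sum>l = 1..k. h k m l)"
    by (simp add: H_fun_def h_def)
  obtain k where k: "k \<in> {1..CARD('n) - 1}"
    "(\<Sum>m = 1..CARD('n) - k. \<Sum>l = 1..k. h k m l) = H_fun A B C \<beta>"
    using idem_sum_attained assms(2) unfolding H by meson
  obtain m where m: "m \<in> {1..CARD('n) - k}" "(\<Sum>l = 1..k. h k m l) = H_fun A B C \<beta>"
    using idem_sum_attained[of "\<lambda>m. \<Sum>l = 1..k. h k m l" "{1..CARD('n) - k}"] assms(2)
    unfolding k(2) by blast
  obtain l where l: "l \<in> {1..k}" "h k m l = H_fun A B C \<beta>"
    using idem_sum_attained[of "h k m" "{1..k}"] assms(2) unfolding m(2) by blast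
  show thesis
    using powq_term_eq_imp[OF _ assms(1)] l k(1) m(1) by (intro that) (auto simp: h_def)
qed

lemma G_fun_le_iff_H_fun_le:
  fixes A B C :: "'a::radicable_semifield ^'n^'n"
  assumes "\<alpha> \<noteq> 0" "\<beta> \<noteq> 0"
  shows "G_fun A B C \<alpha> \<le> \<beta> \<longleftrightarrow> H_fun A B C \<beta> \<le> \<alpha>"
  using assms by (simp add: G_fun_le_iff H_fun_le_iff mult.commute)

text \<open>At \<open>\<alpha>\<close> some inequality is tight, and lowering \<open>\<alpha>\<close> while keeping the value of \<open>G\<close> would violate
  it.\<close>

lemma G_fun_strict_antimono:
  fixes A B C :: "'a::radicable_semifield ^'n^'n"
  assumes "\<alpha>' \<noteq> 0" "G_fun A B C \<alpha> \<noteq> 0" "\<alpha>' < \<alpha>"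
  shows "G_fun A B C \<alpha> < G_fun A B C \<alpha>'"
proof (rule ccontr)
  assume "\<not> G_fun A B C \<alpha> < G_fun A B C \<alpha>'"
  then have le: "G_fun A B C \<alpha>' \<le> G_fun A B C \<alpha>"
    by simp
  have "\<alpha> \<noteq> 0"
    using assms(3) by auto
  then obtain k m l where klm: "k \<in> {1..CARD('n) - 1}" "m \<in> {1..CARD('n) - k}" "l \<in> {1..k}"
    and r: "r_coeff A B C k l m = \<alpha> ^ m * G_fun A B C \<alpha> ^ l"
    using G_fun_attained assms(2) by metis
  have "G_fun A B C \<alpha> ^ l * \<alpha> ^ m \<le> G_fun A B C \<alpha> ^ l * \<alpha>' ^ m"
    using le klm r unfolding G_fun_le_iff[OF assms(1)] by (metis mult.commute)
  then have "\<alpha> ^ m \<le> \<alpha>' ^ m"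
    by (simp add: mult_le_cancel_nonzero nonzero_power[OF assms(2)])
  then have "\<alpha> \<le> \<alpha>'"
    using klm(2) by (simp add: power_le_iff)
  with assms(3) show False
    by simp
qed

text \<open>The reverse inequality holds by \<open>G_fun_le_iff_H_fun_le\<close>, so the curve passes exactly through
  \<open>(H(\<beta>), \<beta>)\<close>; the inequality that is tight for \<open>H(\<beta>)\<close> shows that it does not run below.\<close>

lemma le_G_fun_H_fun:
  fixes A B C :: "'a::radicable_semifield ^'n^'n"
  assumes "\<beta> \<noteq> 0" "H_fun A B C \<beta> \<noteq> 0"
  shows "\<beta> \<le> G_fun A B C (H_fun A B C \<beta>)"
proof -
  define \<alpha> where "\<alpha> = H_fun A B C \<beta>"
  have \<alpha>: "\<alpha> \<noteq> 0"
    using assms(2) by (simp add: \<alpha>_def)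
  obtain k m l where klm: "k \<in> {1..CARD('n) - 1}" "m \<in> {1..CARD('n) - k}" "l \<in> {1..k}"
    and r: "r_coeff A B C k l m = \<beta> ^ l * \<alpha> ^ m"
    using H_fun_attained[OF assms] unfolding \<alpha>_def by metis
  have "r_coeff A B C k l m \<le> \<alpha> ^ m * G_fun A B C \<alpha> ^ l"
    using G_fun_le_iff[OF \<alpha>, of A B C "G_fun A B C \<alpha>"] klm by simp
  then have "\<alpha> ^ m * \<beta> ^ l \<le> \<alpha> ^ m * G_fun A B C \<alpha> ^ l"
    by (simp add: r mult.commute)
  then have "\<beta> ^ l \<le> G_fun A B C \<alpha> ^ l"
    by (simp add: mult_le_cancel_nonzero nonzero_power[OF \<alpha>])
  then show ?thesis
    using klm(3) by (simp add: power_le_iff \<alpha>_def)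
qed

lemma admissible_iff_G_fun:
  assumes "\<alpha> \<noteq> 0"
  shows "admissible A B C \<alpha> \<beta> \<longleftrightarrow> spectral_radius A + mixed_radius A C \<le> \<alpha> \<and>
    spectral_radius B + mixed_radius B C \<le> \<beta> \<and> G_fun A B C \<alpha> \<le> \<beta>"
  by (simp add: admissible_def G_fun_le_iff[OF assms])

text \<open>The corner \<open>(a, b)\<close> bounds all admissible pairs from below; here it is itself admissible.\<close>

lemma minimal_admissible_single:
  fixes A B C :: "'a::radicable_semifield ^'n^'n"
  assumes "a = spectral_radius A + mixed_radius A C" "b = spectral_radius B + mixed_radius B C"
    and "a \<noteq> 0" "b \<noteq> 0" "H_fun A B C b \<le> a"
  shows "minimal_admissible A B C \<alpha> \<beta> \<longleftrightarrow> \<alpha> = a \<and> \<beta> = b"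
proof -
  have "admissible A B C a b"
    using assms by (simp add: admissible_iff_G_fun G_fun_le_iff_H_fun_le)
  moreover have "a \<le> \<alpha>' \<and> b \<le> \<beta>'" if "admissible A B C \<alpha>' \<beta>'" for \<alpha>' \<beta>'
    using that by (simp add: admissible_def assms(1,2))
  ultimately show ?thesis
    unfolding minimal_admissible_def by (metis order_antisym)
qed

text \<open>Here the corner is not admissible. To the right of \<open>H(b)\<close> the pair \<open>(H(b), b)\<close> is smaller, and to
  the left of it the binding lower bound for \<open>\<beta>\<close> is \<open>G(\<alpha>)\<close> rather than \<open>b\<close>.\<close>

lemma minimal_admissible_segment:
  fixes A B C :: "'a::radicable_semifield ^'n^'n"
  assumes a: "a = spectral_radius A + mixed_radius A C"
    and b: "b = spectral_radius B + mixed_radius B C"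
    and nz: "a \<noteq> 0" "b \<noteq> 0" and H: "a < H_fun A B C b"
  shows "minimal_admissible A B C \<alpha> \<beta> \<longleftrightarrow>
    a \<le> \<alpha> \<and> \<alpha> \<le> H_fun A B C b \<and> \<beta> = G_fun A B C \<alpha>"
proof -
  define h where "h = H_fun A B C b"
  have h: "h \<noteq> 0" "a \<le> h"
    using H by (auto simp: h_def)
  have nonzero: "s \<noteq> 0" if "a \<le> s" for s
    using that nz(1) by auto
  have adm: "admissible A B C s t \<longleftrightarrow> a \<le> s \<and> b \<le> t \<and> G_fun A B C s \<le> t" if "a \<le> s" for s t
    using nonzero[OF that] by (simp add: admissible_iff_G_fun a b)
  have adm_ge: "a \<le> s" if "admissible A B C s t" for s t
    using that by (simp add: admissible_def a)
  have b_le_G: "b \<le> G_fun A B C s" if "a \<le> s" "s \<le> h" for s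
  proof (cases "s = h")
    case True
    then show ?thesis
      using le_G_fun_H_fun nz(2) h(1) by (simp add: h_def)
  next
    case False
    then have "\<not> G_fun A B C s \<le> b"
      using that(2) nonzero[OF that(1)] nz(2) by (simp add: G_fun_le_iff_H_fun_le flip: h_def)
    then show ?thesis
      by simp
  qed
  have corner: "admissible A B C h b"
    using h nz(2) by (simp add: adm G_fun_le_iff_H_fun_le h_def)
  show ?thesis
    unfolding h_def[symmetric]
  proof
    assume min: "minimal_admissible A B C \<alpha> \<beta>"
    then have ab: "a \<le> \<alpha>" "b \<le> \<beta>" "G_fun A B C \<alpha> \<le> \<beta>"
      using adm adm_ge unfolding minimal_admissible_def by blast+
    have "\<alpha> \<le> h"
      using min corner ab(2) unfolding minimal_admissible_def by (metis linear)
    moreover have "admissible A B C \<alpha> (G_fun A B C \<alpha>)"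
      using ab(1) b_le_G \<open>\<alpha> \<le> h\<close> by (simp add: adm)
    then have "\<beta> = G_fun A B C \<alpha>"
      using min ab(3) unfolding minimal_admissible_def by blast
    ultimately show "a \<le> \<alpha> \<and> \<alpha> \<le> h \<and> \<beta> = G_fun A B C \<alpha>"
      using ab(1) by simp
  next
    assume asm: "a \<le> \<alpha> \<and> \<alpha> \<le> h \<and> \<beta> = G_fun A B C \<alpha>"
    then have bG: "b \<le> G_fun A B C \<alpha>"
      using b_le_G by simp
    then have G0: "G_fun A B C \<alpha> \<noteq> 0"
      using nz(2) by auto
    have "s = \<alpha> \<and> t = \<beta>" if st: "admissible A B C s t" "s \<le> \<alpha>" "t \<le> \<beta>" for s t
    proof -
      have le: "G_fun A B C s \<le> t"
        using st(1) adm adm_ge by blast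
      then have "\<not> G_fun A B C \<alpha> < G_fun A B C s"
        using st(3) asm by (metis leD order_trans)
      then have "s = \<alpha>"
        using G_fun_strict_antimono[OF nonzero[OF adm_ge[OF st(1)]] G0] st(2)
        by (metis order_le_less)
      with le st(3) asm show ?thesis
        by simp
    qed
    moreover have "admissible A B C \<alpha> \<beta>"
      using asm bG adm by simp
    ultimately show "minimal_admissible A B C \<alpha> \<beta>"
      unfolding minimal_admissible_def by blast
  qed
qed

text \<open>The solutions of \<open>M x \<le> x\<close> are fixed by the star, which gives \<open>u = x\<close>; conversely \<open>M M\<^sup>* \<le> M\<^sup>*\<close>.
  As regular vectors \<open>u\<close> exist, every admissible pair of nonzero bounds is met by a feasible vector.\<close>

lemma feasible_bounds_iff_star:
  fixes A B C :: "'a::radicable_semifield ^'n^'n"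
  assumes "admissible A B C \<alpha> \<beta>" "Tr C \<le> 1" "\<alpha> \<noteq> 0" "\<beta> \<noteq> 0"
  defines "M \<equiv> mat_scale (inverse \<alpha>) A + mat_scale (inverse \<beta>) B + C"
  shows "feasible C x \<and> conj_form x A \<le> \<alpha> \<and> conj_form x B \<le> \<beta> \<longleftrightarrow>
    (\<exists>u. regular u \<and> x = kleene_star M *v u)"
proof
  have Tr: "Tr M \<le> 1"
    unfolding M_def by (rule Tr_le_1_if_admissible[OF assms(1-4)])
  show "\<exists>u. regular u \<and> x = kleene_star M *v u"
    if "feasible C x \<and> conj_form x A \<le> \<alpha> \<and> conj_form x B \<le> \<beta>"
  proof -
    have "regular x"
      using that by (simp add: feasible_def)
    have "M *v x \<le> x"
      unfolding M_def feasible_bounds_iff[OF assms(3,4) \<open>regular x\<close>] by (rule that)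
    then show ?thesis
      using kleene_star_fixes_solution[OF Tr] \<open>regular x\<close> by metis
  qed
  show "feasible C x \<and> conj_form x A \<le> \<alpha> \<and> conj_form x B \<le> \<beta>"
    if star: "\<exists>u. regular u \<and> x = kleene_star M *v u"
  proof -
    obtain u where u: "regular u" "x = kleene_star M *v u"
      using star by blast
    have "u $ i \<le> x $ i" for i
      using le_kleene_star_mult[OF Tr, of u] u(2) by (simp add: less_eq_vec_def)
    then have "regular x"
      using u(1) unfolding regular_def by (metis le_zero_eq)
    have "M *v x \<le> x"
      unfolding u(2) by (rule mult_kleene_star_le[OF Tr])
    then show ?thesis
      unfolding M_def feasible_bounds_iff[OF assms(3,4) \<open>regular x\<close>] .
  qed
qed

text \<open>An admissible pair need not be a pair of objective values, but some feasible vector is at least as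
  good, so a smaller admissible pair always yields a dominating vector.\<close>

lemma pareto_optimal_iff_minimal_admissible:
  fixes A B C :: "'a::radicable_semifield ^'n^'n"
  assumes "Tr C \<le> 1" "spectral_radius A \<noteq> 0" "spectral_radius B \<noteq> 0"
  shows "pareto_optimal A B C x \<longleftrightarrow>
    feasible C x \<and> minimal_admissible A B C (conj_form x A) (conj_form x B)"
proof
  assume opt: "pareto_optimal A B C x"
  have "\<alpha> = conj_form x A \<and> \<beta> = conj_form x B"
    if adm: "admissible A B C \<alpha> \<beta>" and le: "\<alpha> \<le> conj_form x A" "\<beta> \<le> conj_form x B" for \<alpha> \<beta>
  proof -
    have nz: "\<alpha> \<noteq> 0" "\<beta> \<noteq> 0"
      using adm assms(2,3) by (auto simp: admissible_def idem_add_le_iff)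
    \<comment> \<open>The vector of units serves as a regular vector to apply the star to.\<close>
    define y where
      "y = kleene_star (mat_scale (inverse \<alpha>) A + mat_scale (inverse \<beta>) B + C) *v (\<chi> i. 1)"
    have "regular ((\<chi> i. 1) :: 'a ^'n)"
      by (simp add: regular_def)
    then have "feasible C y" "conj_form y A \<le> \<alpha>" "conj_form y B \<le> \<beta>"
      using feasible_bounds_iff_star[OF adm assms(1) nz, of y] y_def by blast+
    with opt le show ?thesis
      unfolding pareto_optimal_def by (meson le_less_trans not_less order_antisym order_trans)
  qed
  with opt show "feasible C x \<and> minimal_admissible A B C (conj_form x A) (conj_form x B)"
    using feasible_admissible unfolding minimal_admissible_def pareto_optimal_def by blast
next
  assume "feasible C x \<and> minimal_admissible A B C (conj_form x A) (conj_form x B)"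
  then show "pareto_optimal A B C x"
    using feasible_admissible unfolding minimal_admissible_def pareto_optimal_def
    by (metis less_irrefl)
qed

theorem theorem3:
  fixes A B C :: "'a::radicable_semifield ^'n^'n"
    and lam \<mu> \<sigma> \<theta> :: 'a
  assumes lambda: "lam = spectral_radius A"
    and mu: "\<mu> = spectral_radius B"
    and sigma: "\<sigma> = mixed_radius A C"
    and theta: "\<theta> = mixed_radius B C"
    and lambda_pos: "lam > 0"
    and mu_pos: "\<mu> > 0"
    and Tr_C: "Tr C \<le> 1"
  shows "(H_fun A B C (\<mu> + \<theta>) \<le> lam + \<sigma> \<longrightarrow>
           pareto_frontier A B C = {(lam + \<sigma>, \<mu> + \<theta>)}) \<and>
         (H_fun A B C (\<mu> + \<theta>) > lam + \<sigma> \<longrightarrow>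
           pareto_frontier A B C =
             {(\<alpha>, \<beta>). lam + \<sigma> \<le> \<alpha> \<and> \<alpha> \<le> H_fun A B C (\<mu> + \<theta>) \<and> \<beta> = G_fun A B C \<alpha>}) \<and>
         {x. pareto_optimal A B C x} =
           {kleene_star (mat_scale (inverse \<alpha>) A + mat_scale (inverse \<beta>) B + C) *v u
             | \<alpha> \<beta> u. (\<alpha>, \<beta>) \<in> pareto_frontier A B C \<and> regular u}"
proof -
  have rad: "spectral_radius A \<noteq> 0" "spectral_radius B \<noteq> 0"
    using lambda mu lambda_pos mu_pos by auto
  have sum_nz: "lam + \<sigma> \<noteq> 0" "\<mu> + \<theta> \<noteq> 0"
    using lambda_pos mu_pos by (metis idem_add_le_iff leD order_refl)+
  note eqs = lambda mu sigma theta
  note pareto = pareto_optimal_iff_minimal_admissible[OF Tr_C rad]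
  \<comment> \<open>By minimality, a feasible vector that meets the bounds attains them.\<close>
  have star: "(feasible C x \<and> conj_form x A = \<alpha> \<and> conj_form x B = \<beta>) \<longleftrightarrow>
      (\<exists>u. regular u \<and>
        x = kleene_star (mat_scale (inverse \<alpha>) A + mat_scale (inverse \<beta>) B + C) *v u)"
    if min: "minimal_admissible A B C \<alpha> \<beta>" for \<alpha> \<beta> x
  proof -
    have adm: "admissible A B C \<alpha> \<beta>"
      using min by (simp add: minimal_admissible_def)
    then have "\<alpha> \<noteq> 0" "\<beta> \<noteq> 0"
      using rad by (auto simp: admissible_def idem_add_le_iff)
    then have "(feasible C x \<and> conj_form x A \<le> \<alpha> \<and> conj_form x B \<le> \<beta>) \<longleftrightarrow>
      (\<exists>u. regular u \<and>
        x = kleene_star (mat_scale (inverse \<alpha>) A + mat_scale (inverse \<beta>) B + C) *v u)"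
      by (rule feasible_bounds_iff_star[OF adm Tr_C])
    moreover have "conj_form x A = \<alpha> \<and> conj_form x B = \<beta>"
      if "feasible C x" "conj_form x A \<le> \<alpha>" "conj_form x B \<le> \<beta>"
      using min feasible_admissible[OF that(1), of A B] that(2,3)
      unfolding minimal_admissible_def by blast
    ultimately show ?thesis
      by auto
  qed
  have frontier: "(\<alpha>, \<beta>) \<in> pareto_frontier A B C \<longleftrightarrow> minimal_admissible A B C \<alpha> \<beta>" for \<alpha> \<beta>
  proof
    assume "(\<alpha>, \<beta>) \<in> pareto_frontier A B C"
    then show "minimal_admissible A B C \<alpha> \<beta>"
      by (auto simp: pareto_frontier_def pareto)
  next
    assume min: "minimal_admissible A B C \<alpha> \<beta>"
    have "regular ((\<chi> i. 1) :: 'a ^'n)"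
      by (simp add: regular_def)
    then obtain x where "feasible C x" "conj_form x A = \<alpha>" "conj_form x B = \<beta>"
      using star[OF min] by blast
    then show "(\<alpha>, \<beta>) \<in> pareto_frontier A B C"
      using min by (auto simp: pareto_frontier_def pareto)
  qed
  have "pareto_frontier A B C = {(lam + \<sigma>, \<mu> + \<theta>)}" if "H_fun A B C (\<mu> + \<theta>) \<le> lam + \<sigma>"
    using minimal_admissible_single[of "lam + \<sigma>" A C "\<mu> + \<theta>" B] that sum_nz frontier
    by (auto simp: eqs)
  moreover have "pareto_frontier A B C =
      {(\<alpha>, \<beta>). lam + \<sigma> \<le> \<alpha> \<and> \<alpha> \<le> H_fun A B C (\<mu> + \<theta>) \<and> \<beta> = G_fun A B C \<alpha>}"
    if "H_fun A B C (\<mu> + \<theta>) > lam + \<sigma>"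
    using minimal_admissible_segment[of "lam + \<sigma>" A C "\<mu> + \<theta>" B] that sum_nz frontier
    by (auto simp: eqs)
  moreover have "pareto_optimal A B C x \<longleftrightarrow> (\<exists>\<alpha> \<beta> u.
      x = kleene_star (mat_scale (inverse \<alpha>) A + mat_scale (inverse \<beta>) B + C) *v u \<and>
      (\<alpha>, \<beta>) \<in> pareto_frontier A B C \<and> regular u)" for x
  proof -
    have "pareto_optimal A B C x \<longleftrightarrow> (\<exists>\<alpha> \<beta>. minimal_admissible A B C \<alpha> \<beta> \<and>
        feasible C x \<and> conj_form x A = \<alpha> \<and> conj_form x B = \<beta>)"
      by (auto simp: pareto)
    also have "\<dots> \<longleftrightarrow> (\<exists>\<alpha> \<beta>. minimal_admissible A B C \<alpha> \<beta> \<and> (\<exists>u. regular u \<and>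
        x = kleene_star (mat_scale (inverse \<alpha>) A + mat_scale (inverse \<beta>) B + C) *v u))"
      using star by (intro ex_cong1 conj_cong) simp_all
    finally show ?thesis
      unfolding frontier by blast
  qed
  ultimately show ?thesis
    by (simp add: set_eq_iff)
qed

end
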